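(* Let $\mathcal{T}_5,\mathcal{T}_6,\dots,\mathcal{T}_{12}$ be the explicit sets of Wang tiles defined in the context, and $\Omega_i=\Omega_{\mathcal{T}_i}$. Then $\Omega_i$ is aperiodic and minimal for every $i$ with $5\le i\le 12$.
   Context: A Wang tile is a tuple $(a,b,c,d)$ giving the colors of the right, top, left and bottom edges of a unit square, in this order. For a finite set $\mathcal{T}$ of Wang tiles, the Wang shift $\Omega_{\mathcal T}$ is the set of all $x:\mathbb{Z}^2\to\mathcal{T}$ such that for every $\mathbf n$ the right color of $x(\mathbf n)$ equals the left color of $x(\mathbf n+\mathbf e_1)$ and the top color of $x(\mathbf n)$ equals the bottom color of $x(\mathbf n+\mathbf e_2)$. The shift is $(\sigma^{\mathbf n}x)_{\mathbf m}=x_{\mathbf m+\mathbf n}$. A subshift is minimal if it contains no nonempty proper closed shift-invariant subset; aperiodic if it is nonempty and no element has a nonzero period. Colors are words over digits. Tiles of each set are indexed from $0$. $\mathcal{T}_5$ (indices 0 to 28): (2113,5,2130,1), (2130,1,2103,5), (2133,1,2113,1), (2113,5,2330,0), (2130,6,2300,0), (2103,5,2310,0), (2310,1,2033,6), (2300,1,2033,6), (2300,0,2030,6), (2030,1,2103,0), (2033,1,2113,0), (2330,1,2133,6), (2330,0,2130,6), (21113,5,21330,1), (21130,6,21300,1), (21103,5,21310,1), (21310,1,21033,5), (21310,0,21030,5), (21300,1,21033,5), (21300,0,21030,5), (21030,1,21103,1), (21033,1,21113,1), (21330,0,21130,1), (21330,0,21130,5), (21130,6,23300,0), (21030,6,23100,0),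 (23100,0,20330,6), (20330,0,21130,0), (23300,0,21330,6). $\mathcal{T}_6$ (indices 0 to 28): (21131,1,21305,1), (21305,5,21031,5), (21331,1,21131,1), (21131,1,23305,0), (21300,0,23006,0), (21031,1,23105,0), (23105,5,20331,6), (23006,6,20331,6), (23006,6,20300,6), (20300,0,21031,0), (20331,1,21131,0), (23305,5,21331,6), (23305,5,21300,6), (211131,1,213305,1), (211300,0,213006,1), (211031,1,213105,1), (213105,5,210331,5), (213105,5,210300,5), (213006,6,210331,5), (213006,6,210300,5), (210300,0,211031,1), (210331,1,211131,1), (213300,0,211300,1), (213305,5,211300,5), (211300,0,233006,0), (210300,0,231006,0), (231006,6,203300,6), (203300,0,211300,0), (233006,6,213300,6). For $i=6,\dots,11$ the set $\mathcal{T}_{i+1}$ is obtained from $\mathcal{T}_i$ and the rule $\omega_i$ below: the tile of index $a$ in $\mathcal{T}_{i+1}$ is the tile $\omega_i(a)$ of $\mathcal{T}_i$ if $\omega_i(a)$ is a single index, and the fusion of the tiles of $\mathcal{T}_i$ of indices $u,v$ if $\omega_i(a)=u|v$. Horizontal fusion ($u$ left, $v$ right) of $u=(Y,B,X,A)$ and $v=(Z,D,Y,C)$ is $(Z,BD,X,AC)$; vertical fusion ($u$ below, $v$ above) of $u=(Y,B,X,A)$ and $v=(Z,D,W,B)$ is $(YZ,D,XW,A)$ (colors are concatenated). Images are listed in the order of the index $a$: $\omega_6$ (horizontal), $a=0..6$: 2, 9, 10, 20, 21, 22, 27; $a=7..19$: 1|0, 6|5, 7|4, 8|4, 11|3, 12|3,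 16|15, 17|15, 18|14, 19|14, 23|13, 26|25, 28|24. $\omega_7$ (horizontal), $a=0..6$: 8, 9, 10, 15, 16, 18, 19; $a=7..19$: 7|0, 7|2, 8|1, 11|2, 12|2, 13|3, 14|3, 15|5, 15|6, 16|5, 16|6, 17|4, 19|6. $\omega_8$ (vertical), $a=0..8$: 3, 4, 5, 6, 12, 13, 14, 15, 18; $a=9..21$: 4|0, 5|0, 5|1, 5|2, 6|0, 13|8, 14|10, 15|10, 16|11, 17|9, 17|11, 18|7, 19|9. $\omega_9$ (horizontal), $a=0..3$: 8, 14, 17, 20; $a=4..17$: 4|1, 5|1, 6|3, 7|2, 8|0, 14|9, 15|13, 16|10, 16|11, 17|13, 18|12, 19|10, 19|11, 21|12. $\omega_{10}$ (vertical), $a=0..8$: 1, 2, 3, 12, 13, 14, 15, 16, 17; $a=9..20$: 1|0, 2|0, 3|0, 9|8, 10|4, 11|4, 12|6, 13|5, 13|8, 14|7, 15|5, 17|7. $\omega_{11}$ (horizontal), $a=0..5$: 5, 8, 14, 15, 18, 20; $a=6..18$: 3|1, 4|2, 5|1, 6|0, 7|1, 8|1, 12|11, 13|11, 14|9, 15|10, 16|11, 17|11, 19|9. *)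

theory Defs
  imports "HOL-Analysis.Analysis"
begin

section \<open>Wang tiles and Wang shifts\<close>

text \<open>
  Colors are words over digits, represented as digit strings, so that concatenation of colors
  is list append. A tile lists its right, top, left and bottom color, in this order.
\<close>

type_synonym color = string
type_synonym tile = "color \<times> color \<times> color \<times> color"

fun right_color :: "tile \<Rightarrow> color" where "right_color (a, b, c, d) = a"
fun top_color :: "tile \<Rightarrow> color" where "top_color (a, b, c, d) = b"
fun left_color :: "tile \<Rightarrow> color" where "left_color (a, b, c, d) = c"
fun bottom_color :: "tile \<Rightarrow> color" where "bottom_color (a, b, c, d) = d"

type_synonym 'a config = "int \<times> int \<Rightarrow> 'a"

definition wang_shift :: "tile set \<Rightarrow> tile config set" where
  "wang_shift T = {x. (\<forall>n. x n \<in> T) \<and>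
     (\<forall>n. right_color (x n) = left_color (x (n + (1, 0)))) \<and>
     (\<forall>n. top_color (x n) = bottom_color (x (n + (0, 1))))}"

section \<open>Subshifts\<close>

definition shift :: "int \<times> int \<Rightarrow> 'a config \<Rightarrow> 'a config" where
  "shift n x = (\<lambda>m. x (m + n))"

definition config_topology :: "'a set \<Rightarrow> 'a config topology" where
  "config_topology A = product_topology (\<lambda>_. discrete_topology A) UNIV"

definition shift_invariant :: "'a config set \<Rightarrow> bool" where
  "shift_invariant X \<longleftrightarrow> (\<forall>n. shift n ` X = X)"

definition subshift :: "'a set \<Rightarrow> 'a config set \<Rightarrow> bool" where
  "subshift A X \<longleftrightarrow> closedin (config_topology A) X \<and> shift_invariant X"

text \<open>
  As usual, the empty subshift is minimal in this sense; nonemptiness is part of aperiodicity.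
\<close>

definition minimal_subshift :: "'a set \<Rightarrow> 'a config set \<Rightarrow> bool" where
  "minimal_subshift A X \<longleftrightarrow> subshift A X \<and>
     \<not> (\<exists>Y. Y \<noteq> {} \<and> Y \<subset> X \<and> closedin (config_topology A) Y \<and> shift_invariant Y)"

definition aperiodic :: "'a config set \<Rightarrow> bool" where
  "aperiodic X \<longleftrightarrow> X \<noteq> {} \<and> \<not> (\<exists>x\<in>X. \<exists>n. n \<noteq> 0 \<and> shift n x = x)"

section \<open>Fusion of tiles\<close>

datatype direction = Horizontal | Vertical

text \<open>
  The tile \<open>u\<close> is the left (respectively the lower) one. The functions are total: they do not
  test that the common edge of the two tiles has the same color on both sides. For the fusions
  performed below this is lemma \<open>rules_fusible\<close>.
\<close>

fun fuse :: "direction \<Rightarrow> tile \<Rightarrow> tile \<Rightarrow> tile" where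
  "fuse Horizontal u v =
     (right_color v, top_color u @ top_color v, left_color u, bottom_color u @ bottom_color v)"
| "fuse Vertical u v =
     (right_color u @ right_color v, top_color v, left_color u @ left_color v, bottom_color u)"

fun fusible :: "direction \<Rightarrow> tile \<Rightarrow> tile \<Rightarrow> bool" where
  "fusible Horizontal u v \<longleftrightarrow> right_color u = left_color v"
| "fusible Vertical u v \<longleftrightarrow> top_color u = bottom_color v"

datatype rule_image = Single nat | Fused nat nat

fun image_tile :: "direction \<Rightarrow> tile list \<Rightarrow> rule_image \<Rightarrow> tile" where
  "image_tile d ts (Single u) = ts ! u"
| "image_tile d ts (Fused u v) = fuse d (ts ! u) (ts ! v)"

fun valid_image :: "direction \<Rightarrow> tile list \<Rightarrow> rule_image \<Rightarrow> bool" where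
  "valid_image d ts (Single u) \<longleftrightarrow> u < length ts"
| "valid_image d ts (Fused u v) \<longleftrightarrow>
     u < length ts \<and> v < length ts \<and> fusible d (ts ! u) (ts ! v)"

section \<open>The tile sets\<close>

definition tiles5 :: "tile list" where
  "tiles5 =
     [(''2113'', ''5'', ''2130'', ''1''), (''2130'', ''1'', ''2103'', ''5''),
      (''2133'', ''1'', ''2113'', ''1''), (''2113'', ''5'', ''2330'', ''0''),
      (''2130'', ''6'', ''2300'', ''0''), (''2103'', ''5'', ''2310'', ''0''),
      (''2310'', ''1'', ''2033'', ''6''), (''2300'', ''1'', ''2033'', ''6''),
      (''2300'', ''0'', ''2030'', ''6''), (''2030'', ''1'', ''2103'', ''0''),
      (''2033'', ''1'', ''2113'', ''0''), (''2330'', ''1'', ''2133'', ''6''),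
      (''2330'', ''0'', ''2130'', ''6''), (''21113'', ''5'', ''21330'', ''1''),
      (''21130'', ''6'', ''21300'', ''1''), (''21103'', ''5'', ''21310'', ''1''),
      (''21310'', ''1'', ''21033'', ''5''), (''21310'', ''0'', ''21030'', ''5''),
      (''21300'', ''1'', ''21033'', ''5''), (''21300'', ''0'', ''21030'', ''5''),
      (''21030'', ''1'', ''21103'', ''1''), (''21033'', ''1'', ''21113'', ''1''),
      (''21330'', ''0'', ''21130'', ''1''), (''21330'', ''0'', ''21130'', ''5''),
      (''21130'', ''6'', ''23300'', ''0''), (''21030'', ''6'', ''23100'', ''0''),
      (''23100'', ''0'', ''20330'', ''6''), (''20330'', ''0'', ''21130'', ''0''),
      (''23300'', ''0'', ''21330'', ''6'')]"

definition tiles6 :: "tile list" where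
  "tiles6 =
     [(''21131'', ''1'', ''21305'', ''1''), (''21305'', ''5'', ''21031'', ''5''),
      (''21331'', ''1'', ''21131'', ''1''), (''21131'', ''1'', ''23305'', ''0''),
      (''21300'', ''0'', ''23006'', ''0''), (''21031'', ''1'', ''23105'', ''0''),
      (''23105'', ''5'', ''20331'', ''6''), (''23006'', ''6'', ''20331'', ''6''),
      (''23006'', ''6'', ''20300'', ''6''), (''20300'', ''0'', ''21031'', ''0''),
      (''20331'', ''1'', ''21131'', ''0''), (''23305'', ''5'', ''21331'', ''6''),
      (''23305'', ''5'', ''21300'', ''6''), (''211131'', ''1'', ''213305'', ''1''),
      (''211300'', ''0'', ''213006'', ''1''), (''211031'', ''1'', ''213105'', ''1''),
      (''213105'', ''5'', ''210331'', ''5''), (''213105'', ''5'', ''210300'', ''5''),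
      (''213006'', ''6'', ''210331'', ''5''), (''213006'', ''6'', ''210300'', ''5''),
      (''210300'', ''0'', ''211031'', ''1''), (''210331'', ''1'', ''211131'', ''1''),
      (''213300'', ''0'', ''211300'', ''1''), (''213305'', ''5'', ''211300'', ''5''),
      (''211300'', ''0'', ''233006'', ''0''), (''210300'', ''0'', ''231006'', ''0''),
      (''231006'', ''6'', ''203300'', ''6''), (''203300'', ''0'', ''211300'', ''0''),
      (''233006'', ''6'', ''213300'', ''6'')]"

definition omega6 :: "rule_image list" where
  "omega6 =
    [Single 2, Single 9, Single 10, Single 20, Single 21, Single 22, Single 27,
     Fused 1 0, Fused 6 5, Fused 7 4, Fused 8 4, Fused 11 3, Fused 12 3, Fused 16 15,
     Fused 17 15, Fused 18 14, Fused 19 14, Fused 23 13, Fused 26 25, Fused 28 24]"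

definition omega7 :: "rule_image list" where
  "omega7 =
    [Single 8, Single 9, Single 10, Single 15, Single 16, Single 18, Single 19,
     Fused 7 0, Fused 7 2, Fused 8 1, Fused 11 2, Fused 12 2, Fused 13 3, Fused 14 3,
     Fused 15 5, Fused 15 6, Fused 16 5, Fused 16 6, Fused 17 4, Fused 19 6]"

definition omega8 :: "rule_image list" where
  "omega8 =
    [Single 3, Single 4, Single 5, Single 6, Single 12, Single 13, Single 14,
     Single 15, Single 18, Fused 4 0, Fused 5 0, Fused 5 1, Fused 5 2, Fused 6 0,
     Fused 13 8, Fused 14 10, Fused 15 10, Fused 16 11, Fused 17 9, Fused 17 11, Fused 18 7,
     Fused 19 9]"

definition omega9 :: "rule_image list" where
  "omega9 =
    [Single 8, Single 14, Single 17, Single 20, Fused 4 1, Fused 5 1, Fused 6 3,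
     Fused 7 2, Fused 8 0, Fused 14 9, Fused 15 13, Fused 16 10, Fused 16 11, Fused 17 13,
     Fused 18 12, Fused 19 10, Fused 19 11, Fused 21 12]"

definition omega10 :: "rule_image list" where
  "omega10 =
    [Single 1, Single 2, Single 3, Single 12, Single 13, Single 14, Single 15,
     Single 16, Single 17, Fused 1 0, Fused 2 0, Fused 3 0, Fused 9 8, Fused 10 4,
     Fused 11 4, Fused 12 6, Fused 13 5, Fused 13 8, Fused 14 7, Fused 15 5, Fused 17 7]"

definition omega11 :: "rule_image list" where
  "omega11 =
    [Single 5, Single 8, Single 14, Single 15, Single 18, Single 20, Fused 3 1,
     Fused 4 2, Fused 5 1, Fused 6 0, Fused 7 1, Fused 8 1, Fused 12 11, Fused 13 11,
     Fused 14 9, Fused 15 10, Fused 16 11, Fused 17 11, Fused 19 9]"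

text \<open>
  \<open>tile_list i\<close> is the set \<open>T\<^sub>i\<close> with its indexing; it is only meaningful for \<open>5 \<le> i \<le> 12\<close>.
\<close>

definition rule_direction :: "nat \<Rightarrow> direction" where
  "rule_direction i = (if i = 8 \<or> i = 10 then Vertical else Horizontal)"

definition rule_images :: "nat \<Rightarrow> rule_image list" where
  "rule_images i =
    (if i = 6 then omega6 else if i = 7 then omega7 else if i = 8 then omega8
     else if i = 9 then omega9 else if i = 10 then omega10 else if i = 11 then omega11
     else [])"

fun tile_list :: "nat \<Rightarrow> tile list" where
  "tile_list 0 = []"
| "tile_list (Suc i) =
    (if Suc i = 5 then tiles5 else if Suc i = 6 then tiles6
     else map (image_tile (rule_direction i) (tile_list i)) (rule_images i))"

definition tile_set :: "nat \<Rightarrow> tile set" where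
  "tile_set i = set (tile_list i)"

section \<open>Sanity checks\<close>

lemma rules_fusible:
  "list_all (\<lambda>i. list_all (valid_image (rule_direction i) (tile_list i)) (rule_images i))
     [6, 7, 8, 9, 10, 11]"
  by code_simp

lemma tile_lists_distinct: "list_all (\<lambda>i. distinct (tile_list i)) [5, 6, 7, 8, 9, 10, 11, 12]"
  by code_simp

lemma tile_list_lengths:
  "map (\<lambda>i. length (tile_list i)) [5, 6, 7, 8, 9, 10, 11, 12] = [29, 29, 20, 20, 22, 18, 21, 19]"
  by code_simp

lemma shift_0 [simp]: "shift 0 x = x"
  by (simp add: shift_def)

lemma shift_shift [simp]: "shift m (shift n x) = shift (m + n) x"
  by (simp add: shift_def add_ac)

lemma subshift_wang_shift: "subshift T (wang_shift T)"
proof -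
  let ?X = "config_topology T"
  have closed: "closedin ?X {x \<in> topspace ?X. R (x m) (x n)}"
    for R :: "tile \<Rightarrow> tile \<Rightarrow> bool" and m n :: "int \<times> int"
  proof -
    have "continuous_map ?X (prod_topology (discrete_topology T) (discrete_topology T))
            (\<lambda>x. (x m, x n))"
      unfolding config_topology_def
      by (intro continuous_map_pairedI continuous_map_product_projection) auto
    then have cont: "continuous_map ?X (discrete_topology (T \<times> T)) (\<lambda>x. (x m, x n))"
      by (simp add: prod_topology_discrete_topology)
    have eq: "{x \<in> topspace ?X. R (x m) (x n)} =
              {x \<in> topspace ?X. (x m, x n) \<in> {p \<in> T \<times> T. R (fst p) (snd p)}}"
      by (auto simp: config_topology_def PiE_def Pi_def simp del: split_paired_All)
    show ?thesis
      unfolding eq by (rule closedin_continuous_map_preimage[OF cont]) auto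
  qed
  have "wang_shift T =
      (\<Inter>n. {x \<in> topspace ?X. right_color (x n) = left_color (x (n + (1, 0)))} \<inter>
           {x \<in> topspace ?X. top_color (x n) = bottom_color (x (n + (0, 1)))})"
    by (auto simp: wang_shift_def config_topology_def PiE_def Pi_def simp del: split_paired_All)
  moreover have "closedin ?X \<dots>"
    by (intro closedin_Inter ballI) (auto intro: closed)
  ultimately have "closedin ?X (wang_shift T)"
    by simp
  moreover have sub: "shift n ` wang_shift T \<subseteq> wang_shift T" for n
    by (clarify, simp del: split_paired_All add: wang_shift_def shift_def add_ac)
  have "wang_shift T \<subseteq> shift n ` wang_shift T" for n
  proof
    fix x assume "x \<in> wang_shift T"
    then have "shift (- n) x \<in> wang_shift T"
      using sub by blast
    then show "x \<in> shift n ` wang_shift T"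
      by (intro image_eqI[of _ _ "shift (- n) x"]) simp_all
  qed
  with sub have "shift_invariant (wang_shift T)"
    unfolding shift_invariant_def by blast
  ultimately show ?thesis
    by (simp add: subshift_def)
qed

end

theory Submission
  imports Defs
begin

text \<open>
  Pruning the color adjacencies of each tile set to those that extend to a \<open>2 \<times> 2\<close> square leaves
  relations in which some tiles (the markers) fill whole columns (or rows), no two of them adjacent.
  So every tiling of level \<open>i\<close> arises from one of level \<open>i + 1\<close> by replacing letters with words,
  in only one way. Two further fusions lead from level 12 back to level 12, which makes level 12
  self-similar. Periods desubstitute to periods, and strictly shorter ones after the two fusions of
  level 12, so there are none. A window of a tiling of level 12 is covered by the inflation of a
  smaller window until only \<open>2 \<times> 2\<close> squares remain; there are finitely many of these, and each
  is found in the iterated inflation of every tile, so every window recurs in every tiling.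
  Conversely, valid patches inflate to larger ones, and compactness gives a tiling. Desubstitution
  transports all three properties down to level 6, and the shear \<open>(i, j) \<mapsto> (i + j, j)\<close>,
  which preserves tile indices, to level 5.
\<close>

section \<open>Tilings by adjacency relations\<close>

text \<open>The colors alone do not show the markers: at level 6, tile 2 could sit on the marker 0,
  and only pruning excludes it. The pruned adjacencies are stored as tables of tile indices and
  recomputed from the colors. A word has length 1 or 2, so a fusion has no fixed rate of growth.
  Below level 12, windows merely must not get larger under desubstitution; growth is demanded only
  of the cycle from level 12 to itself, in the form that two neighboring letters never both stand
  alone. This enlarges windows of width at least 3, but a window of width 2 may lie across a seam on
  every level. Hence the squares of side 2 are settled by a finite search, and the passage from 2 to
  3 has an argument of its own that uses both levels of the cycle. Inflations of whole tilings are
  never constructed: recurrence and periods only use desubstitution, and existence works with finite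
  patches, where no bi-infinite sequence of column positions is required.\<close>

definition tilings :: "(nat \<Rightarrow> nat \<Rightarrow> bool) \<Rightarrow> (nat \<Rightarrow> nat \<Rightarrow> bool) \<Rightarrow> (int \<Rightarrow> int \<Rightarrow> nat) set" where
  "tilings h v = {x. \<forall>i j. h (x i j) (x (i + 1) j) \<and> v (x i j) (x i (j + 1))}"

text \<open>A vertical fusion is a horizontal one of the transposed tiling, so the theory of fusion
  is developed for columns only.\<close>

definition flip :: "('a \<Rightarrow> 'a \<Rightarrow> 'b) \<Rightarrow> 'a \<Rightarrow> 'a \<Rightarrow> 'b" where
  "flip x = (\<lambda>i j. x j i)"

lemma flip_flip [simp]: "flip (flip x) = x"
  by (simp add: flip_def)

lemma flip_apply [simp]: "flip x i j = x j i"
  by (simp add: flip_def)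

lemma flip_image_iff: "x \<in> flip ` X \<longleftrightarrow> flip x \<in> X"
  by (metis flip_flip image_iff)

lemma flip_in_tilings [simp]: "flip x \<in> tilings h v \<longleftrightarrow> x \<in> tilings v h"
  by (auto simp: tilings_def)

lemma flip_tilings [simp]: "flip ` tilings h v = tilings v h"
  by (auto simp: flip_image_iff)

lemma tilingsD:
  assumes "x \<in> tilings h v"
  shows "h (x i j) (x (i + 1) j)" and "v (x i j) (x i (j + 1))"
  using assms by (auto simp: tilings_def)

lemma tilings_mono:
  assumes "x \<in> tilings h v" and "\<And>a b. h a b \<Longrightarrow> h' a b" and "\<And>a b. v a b \<Longrightarrow> v' a b"
  shows "x \<in> tilings h' v'"
  using assms by (auto simp: tilings_def)

section \<open>Local consistency of adjacency relations\<close>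

text \<open>
  The functions on boolean matrices match on constructors and take no functional arguments, since
  \<open>code_simp\<close> also rewrites below abstractions, where \<open>nth\<close> of a long list would be unfolded.
\<close>

fun holds :: "bool list \<Rightarrow> nat \<Rightarrow> bool" where
  "holds [] i = False"
| "holds (x # xs) 0 = x"
| "holds (x # xs) (Suc i) = holds xs i"

fun entry :: "bool list list \<Rightarrow> nat \<Rightarrow> nat \<Rightarrow> bool" where
  "entry [] i j = False"
| "entry (r # rs) 0 j = holds r j"
| "entry (r # rs) (Suc i) j = entry rs i j"

fun disj :: "bool list \<Rightarrow> bool list \<Rightarrow> bool list" where
  "disj (x # xs) (y # ys) = (x \<or> y) # disj xs ys"
| "disj [] ys = ys"
| "disj (x # xs) [] = x # xs"

fun meets :: "bool list \<Rightarrow> bool list \<Rightarrow> bool" where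
  "meets (x # xs) (y # ys) \<longleftrightarrow> (x \<and> y) \<or> meets xs ys"
| "meets _ _ \<longleftrightarrow> False"

fun reach :: "bool list \<Rightarrow> bool list list \<Rightarrow> bool list" where
  "reach (True # xs) (r # rs) = disj r (reach xs rs)"
| "reach (False # xs) (r # rs) = reach xs rs"
| "reach _ _ = []"

fun prune_row :: "bool list \<Rightarrow> bool list list \<Rightarrow> bool list \<Rightarrow> bool list" where
  "prune_row (True # xs) (r # rs) us = meets r us # prune_row xs rs us"
| "prune_row (False # xs) (r # rs) us = False # prune_row xs rs us"
| "prune_row _ _ us = []"

fun prune_rows ::
    "bool list list \<Rightarrow> bool list list \<Rightarrow> bool list list \<Rightarrow> bool list list \<Rightarrow> bool list list" where
  "prune_rows A B (r # rs) (s # ss) = prune_row r B (reach s A) # prune_rows A B rs ss"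
| "prune_rows A B _ _ = []"

text \<open>
  Keeps the dominoes of \<open>A\<close> that have a domino of \<open>A\<close> on their side in the direction of \<open>B\<close>.
\<close>

definition prune :: "bool list list \<Rightarrow> bool list list \<Rightarrow> bool list list" where
  "prune A B = prune_rows A B A B"

fun cons_column :: "bool list \<Rightarrow> bool list list \<Rightarrow> bool list list" where
  "cons_column (x # xs) (c # cs) = (x # c) # cons_column xs cs"
| "cons_column (x # xs) [] = [x] # cons_column xs []"
| "cons_column [] (c # cs) = (False # c) # cons_column [] cs"
| "cons_column [] [] = []"

fun converse_matrix :: "bool list list \<Rightarrow> bool list list" where
  "converse_matrix [] = []"
| "converse_matrix (r # rs) = cons_column r (converse_matrix rs)"

definition prune_both :: "bool list list \<Rightarrow> bool list list \<Rightarrow> bool list list" where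
  "prune_both A B = prune (prune A B) (converse_matrix B)"

text \<open>Each round prunes the horizontal dominoes and then the vertical ones against the result.
  The pruned matrix is passed on as an argument because \<open>refine_vertical\<close> uses it
  twice.\<close>

fun refine and refine_vertical where
  "refine 0 A B = (A, B)"
| "refine (Suc k) A B = refine_vertical k (prune_both A B) B"
| "refine_vertical k A B = refine k A (prune_both B A)"

lemma holds_disj: "holds (disj xs ys) i \<longleftrightarrow> holds xs i \<or> holds ys i"
proof (induction xs ys arbitrary: i rule: disj.induct)
  case (1 x xs y ys)
  then show ?case by (cases i) auto
qed auto

lemma holds_reach: "holds xs c \<Longrightarrow> entry rs c d \<Longrightarrow> holds (reach xs rs) d"
proof (induction xs rs arbitrary: c rule: reach.induct)
  case (1 xs r rs)
  then show ?case by (cases c) (auto simp: holds_disj)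
next
  case (2 xs r rs)
  then show ?case by (cases c) auto
qed auto

lemma meetsI: "holds xs i \<Longrightarrow> holds ys i \<Longrightarrow> meets xs ys"
proof (induction xs ys arbitrary: i rule: meets.induct)
  case (1 x xs y ys)
  then show ?case by (cases i) auto
qed auto

lemma holds_prune_row:
  "holds xs b \<Longrightarrow> entry rs b d \<Longrightarrow> holds us d \<Longrightarrow> holds (prune_row xs rs us) b"
proof (induction xs rs us arbitrary: b rule: prune_row.induct)
  case (1 xs r rs us)
  then show ?case by (cases b) (auto intro: meetsI)
next
  case (2 xs r rs us)
  then show ?case by (cases b) auto
qed auto

lemma holds_prune_rowD: "holds (prune_row xs rs us) b \<Longrightarrow> holds xs b"
proof (induction xs rs us arbitrary: b rule: prune_row.induct)
  case (1 xs r rs us)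
  then show ?case by (cases b) auto
next
  case (2 xs r rs us)
  then show ?case by (cases b) auto
qed auto

lemma entry_prune_rows:
  "entry rs a b \<Longrightarrow> entry ss a c \<Longrightarrow> entry A c d \<Longrightarrow> entry B b d \<Longrightarrow>
   entry (prune_rows A B rs ss) a b"
proof (induction A B rs ss arbitrary: a rule: prune_rows.induct)
  case (1 A B r rs s ss)
  then show ?case by (cases a) (auto intro: holds_prune_row holds_reach)
qed auto

lemma entry_prune_rowsD: "entry (prune_rows A B rs ss) a b \<Longrightarrow> entry rs a b"
proof (induction A B rs ss arbitrary: a rule: prune_rows.induct)
  case (1 A B r rs s ss)
  then show ?case by (cases a) (auto dest: holds_prune_rowD)
qed auto

lemma entry_pruneD: "entry (prune A B) a b \<Longrightarrow> entry A a b"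
  unfolding prune_def by (rule entry_prune_rowsD)

lemma entry_cons_column_0: "holds xs b \<Longrightarrow> entry (cons_column xs cs) b 0"
proof (induction xs cs arbitrary: b rule: cons_column.induct)
  case (1 x xs c cs)
  then show ?case by (cases b) auto
next
  case (2 x xs)
  then show ?case by (cases b) auto
qed auto

lemma entry_cons_column_Suc: "entry cs b a \<Longrightarrow> entry (cons_column xs cs) b (Suc a)"
proof (induction xs cs arbitrary: b rule: cons_column.induct)
  case (1 x xs c cs)
  then show ?case by (cases b) auto
next
  case (3 c cs)
  then show ?case by (cases b) auto
qed auto

lemma entry_converse_matrix: "entry A a b \<Longrightarrow> entry (converse_matrix A) b a"
proof (induction A arbitrary: a)
  case (Cons r rs)
  then show ?case by (cases a) (auto simp: entry_cons_column_0 entry_cons_column_Suc)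
qed auto

lemma tilings_prune:
  assumes x: "x \<in> tilings (entry A) (entry B)"
  shows "x \<in> tilings (entry (prune A B)) (entry B)"
proof -
  have "entry (prune A B) (x i j) (x (i + 1) j)" for i j
    unfolding prune_def
    using tilingsD[OF x, of i j] tilingsD[OF x, of "i + 1" j] tilingsD[OF x, of i "j + 1"]
    by (blast intro: entry_prune_rows)
  with x show ?thesis
    by (simp add: tilings_def)
qed

text \<open>Turning a tiling upside down reverses the vertical relation. Soundness of pruning on one
  side thereby yields soundness on the other side, with \<open>converse_matrix B\<close> in place of
  \<open>B\<close>.\<close>

lemma tilings_reflect:
  assumes "x \<in> tilings h v" and "\<And>a b. v a b \<Longrightarrow> v' b a"
  shows "(\<lambda>i j. x i (- j)) \<in> tilings h v'"
proof -
  have "v' (x i (- j)) (x i (- (j + 1)))" for i j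
    using assms(2)[OF tilingsD(2)[OF assms(1), of i "- (j + 1)"]] by simp
  with assms(1) show ?thesis
    by (simp add: tilings_def)
qed

lemma tilings_prune_both:
  assumes x: "x \<in> tilings (entry A) (entry B)"
  shows "x \<in> tilings (entry (prune_both A B)) (entry B)"
proof -
  let ?y = "\<lambda>i j. x i (- j)"
  have "?y \<in> tilings (entry (prune A B)) (entry (converse_matrix B))"
    by (rule tilings_reflect[OF tilings_prune[OF x]]) (rule entry_converse_matrix)
  then have y: "?y \<in> tilings (entry (prune_both A B)) (entry (converse_matrix B))"
    unfolding prune_both_def by (rule tilings_prune)
  have "entry (prune_both A B) (x i j) (x (i + 1) j)" for i j
    using tilingsD(1)[OF y, of i "- j"] by simp
  with x show ?thesis
    by (simp add: tilings_def)
qed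

lemma tilings_refine:
  "x \<in> tilings (entry A) (entry B) \<Longrightarrow> refine k A B = (A', B') \<Longrightarrow>
   x \<in> tilings (entry A') (entry B')"
proof (induction k arbitrary: A B)
  case (Suc k)
  have "x \<in> tilings (entry (prune_both A B)) (entry B)"
    by (rule tilings_prune_both[OF Suc.prems(1)])
  then have "flip x \<in> tilings (entry (prune_both B (prune_both A B))) (entry (prune_both A B))"
    by (intro tilings_prune_both) simp
  then have "x \<in> tilings (entry (prune_both A B)) (entry (prune_both B (prune_both A B)))"
    by simp
  from Suc.IH[OF this] Suc.prems(2) show ?case
    by simp
qed simp

lemma entry_prune_bothD: "entry (prune_both A B) a b \<Longrightarrow> entry A a b"
  unfolding prune_both_def by (blast dest: entry_pruneD)

lemma entry_refineD:
  "refine k A B = (A', B') \<Longrightarrow>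
   (entry A' a b \<longrightarrow> entry A a b) \<and> (entry B' a b \<longrightarrow> entry B a b)"
proof (induction k arbitrary: A B)
  case (Suc k)
  from Suc.prems have "refine k (prune_both A B) (prune_both B (prune_both A B)) = (A', B')"
    by simp
  from Suc.IH[OF this] show ?case
    by (meson entry_prune_bothD)
qed simp

definition adj :: "nat list list \<Rightarrow> nat \<Rightarrow> nat \<Rightarrow> bool" where
  "adj A a b \<longleftrightarrow> a < length A \<and> b \<in> set (A ! a)"

definition matrix :: "nat list list \<Rightarrow> bool list list" where
  "matrix A = map (\<lambda>bs. map (\<lambda>b. b \<in> set bs) [0..<length A]) A"

lemma holds_iff_nth: "holds xs i \<longleftrightarrow> i < length xs \<and> xs ! i"
  by (induction xs i rule: holds.induct) auto

lemma entry_iff_nth: "entry A i j \<longleftrightarrow> i < length A \<and> holds (A ! i) j"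
  by (induction A i j rule: entry.induct) auto

lemma entry_matrix: "entry (matrix A) a b \<longleftrightarrow> adj A a b \<and> b < length A"
  by (auto simp: entry_iff_nth holds_iff_nth matrix_def adj_def)

definition colour_matrix ::
    "(tile \<Rightarrow> color) \<Rightarrow> (tile \<Rightarrow> color) \<Rightarrow> tile list \<Rightarrow> bool list list" where
  "colour_matrix f g ts = map (\<lambda>s. map (\<lambda>t. f s = g t) ts) ts"

definition h_adj :: "tile list \<Rightarrow> nat \<Rightarrow> nat \<Rightarrow> bool" where
  "h_adj ts a b \<longleftrightarrow>
     a < length ts \<and> b < length ts \<and> right_color (ts ! a) = left_color (ts ! b)"

definition v_adj :: "tile list \<Rightarrow> nat \<Rightarrow> nat \<Rightarrow> bool" where
  "v_adj ts a b \<longleftrightarrow>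
     a < length ts \<and> b < length ts \<and> top_color (ts ! a) = bottom_color (ts ! b)"

lemma entry_colour_matrix:
  "entry (colour_matrix right_color left_color ts) = h_adj ts"
  "entry (colour_matrix top_color bottom_color ts) = v_adj ts"
  by (auto simp: fun_eq_iff entry_iff_nth holds_iff_nth colour_matrix_def h_adj_def v_adj_def)

text \<open>Pruning only deletes dominoes. With \<open>tilings_refined\<close>, the color
  adjacencies and the tables have the same tilings. The bounds matter because \<open>matrix\<close>
  drops successors that are out of range.\<close>

lemma refined_adj_imp:
  assumes ref: "refine k (colour_matrix right_color left_color ts)
        (colour_matrix top_color bottom_color ts) = (matrix A, matrix B)"
    and "list_all (\<lambda>bs. list_all (\<lambda>b. b < length A) bs) A"
    and "list_all (\<lambda>bs. list_all (\<lambda>b. b < length B) bs) B"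
  shows "adj A a b \<Longrightarrow> h_adj ts a b" and "adj B a b \<Longrightarrow> v_adj ts a b"
proof -
  assume "adj A a b"
  with assms(2) have "entry (matrix A) a b"
    by (auto simp: entry_matrix adj_def list_all_iff)
  then show "h_adj ts a b"
    using entry_refineD[OF ref] by (simp add: entry_colour_matrix)
next
  assume "adj B a b"
  with assms(3) have "entry (matrix B) a b"
    by (auto simp: entry_matrix adj_def list_all_iff)
  then show "v_adj ts a b"
    using entry_refineD[OF ref] by (simp add: entry_colour_matrix)
qed

lemma tilings_refined:
  assumes ref: "refine k (colour_matrix right_color left_color ts)
        (colour_matrix top_color bottom_color ts) = (matrix A, matrix B)"
    and x: "x \<in> tilings (h_adj ts) (v_adj ts)"
  shows "x \<in> tilings (adj A) (adj B)"
proof -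
  from x have "x \<in> tilings (entry (matrix A)) (entry (matrix B))"
    by (intro tilings_refine[OF _ ref]) (simp add: entry_colour_matrix)
  then show ?thesis
    by (rule tilings_mono) (auto simp: entry_matrix)
qed

section \<open>Fusing columns\<close>

definition seconds :: "nat list list \<Rightarrow> nat set" where
  "seconds W = set (concat (map tl W))"

text \<open>
  The letters in \<open>seconds W\<close> are the markers: each is fused with the letter on its left, and they
  fill whole columns.
\<close>

definition fusing :: "nat list list \<Rightarrow> (nat \<Rightarrow> nat \<Rightarrow> bool) \<Rightarrow> (nat \<Rightarrow> nat \<Rightarrow> bool) \<Rightarrow> bool" where
  "fusing W h v \<longleftrightarrow>
     distinct W \<and>
     (\<forall>w\<in>set W. length w \<in> {1, 2} \<and> hd w \<notin> seconds W) \<and>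
     (\<forall>a b. h a b \<longrightarrow> b \<in> seconds W \<longrightarrow> [a, b] \<in> set W) \<and>
     (\<forall>a b. h a b \<longrightarrow> a \<notin> seconds W \<longrightarrow> b \<notin> seconds W \<longrightarrow> [a] \<in> set W) \<and>
     (\<forall>a b. v a b \<longrightarrow> (a \<in> seconds W \<longleftrightarrow> b \<in> seconds W))"

text \<open>
  The configuration \<open>x\<close> is \<open>y\<close> with every letter replaced by its word; column \<open>k\<close> of \<open>y\<close> becomes
  the columns of \<open>x\<close> from \<open>p k\<close> on.
\<close>

definition inflates ::
    "nat list list \<Rightarrow> (int \<Rightarrow> int) \<Rightarrow> (int \<Rightarrow> int \<Rightarrow> nat) \<Rightarrow> (int \<Rightarrow> int \<Rightarrow> nat) \<Rightarrow> bool" where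
  "inflates W p y x \<longleftrightarrow>
     (\<forall>k j. y k j < length W \<and> length (W ! y k j) \<in> {1, 2} \<and>
        p (k + 1) = p k + int (length (W ! y k j)) \<and>
        (\<forall>r < length (W ! y k j). x (p k + int r) j = W ! y k j ! r))"

definition lift_h :: "nat list list \<Rightarrow> (nat \<Rightarrow> nat \<Rightarrow> bool) \<Rightarrow> nat \<Rightarrow> nat \<Rightarrow> bool" where
  "lift_h W h a b \<longleftrightarrow> a < length W \<and> b < length W \<and> h (last (W ! a)) (hd (W ! b))"

definition lift_v :: "nat list list \<Rightarrow> (nat \<Rightarrow> nat \<Rightarrow> bool) \<Rightarrow> nat \<Rightarrow> nat \<Rightarrow> bool" where
  "lift_v W v a b \<longleftrightarrow> a < length W \<and> b < length W \<and> list_all2 v (W ! a) (W ! b)"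

text \<open>Negative indices are reached by iterating a right inverse of \<open>f\<close>. The lemma
  serves to enumerate the columns without markers, \<open>f\<close> being the step to the next
  one.\<close>

lemma ex_biinfinite_orbit:
  assumes "P a" and "\<And>i. P i \<Longrightarrow> P (f i)" and "\<And>i. P i \<Longrightarrow> \<exists>j. P j \<and> f j = i"
  shows "\<exists>p :: int \<Rightarrow> 'a. \<forall>k. P (p k) \<and> p (k + 1) = f (p k)"
proof -
  from assms(3) obtain g where g: "\<And>i. P i \<Longrightarrow> P (g i) \<and> f (g i) = i"
    by metis
  define p where "p k = (if 0 \<le> k then (f ^^ nat k) a else (g ^^ nat (- k)) a)" for k :: int
  have f: "P ((f ^^ n) a)" for n
    by (induction n) (auto intro: assms)
  have g': "P ((g ^^ n) a)" for n
    by (induction n) (auto simp: assms(1) g)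
  have "p (k + 1) = f (p k)" for k
  proof (cases "0 \<le> k")
    case True
    then have "nat (k + 1) = Suc (nat k)" by simp
    with True show ?thesis by (simp add: p_def)
  next
    case False
    then have "nat (- k) = Suc (nat (- (k + 1)))" by simp
    with False have "p k = g ((g ^^ nat (- (k + 1))) a)"
      by (simp add: p_def)
    with g[OF g'] have "f (p k) = (g ^^ nat (- (k + 1))) a"
      by simp
    with False show ?thesis
      by (cases "k = -1") (auto simp: p_def)
  qed
  moreover have "P (p k)" for k
    by (simp add: p_def f g')
  ultimately show ?thesis
    by blast
qed

text \<open>Vertical adjacency makes being a marker a property of whole columns, so the cuts in
  front of the unmarked columns are the same in every row.\<close>

lemma ex_desubstitution:
  assumes x: "x \<in> tilings h v" and W: "fusing W h v"
  shows "\<exists>y\<in>tilings (lift_h W h) (lift_v W v). \<exists>p. inflates W p y x"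
proof -
  define S where "S = seconds W"
  define mk where "mk i \<longleftrightarrow> x i 0 \<in> S" for i
  from W have W1: "\<And>a b. h a b \<Longrightarrow> b \<in> S \<Longrightarrow> [a, b] \<in> set W"
    and W2: "\<And>a b. h a b \<Longrightarrow> a \<notin> S \<Longrightarrow> b \<notin> S \<Longrightarrow> [a] \<in> set W"
    and W3: "\<And>a b. v a b \<Longrightarrow> a \<in> S \<longleftrightarrow> b \<in> S"
    and W4: "\<And>w. w \<in> set W \<Longrightarrow> hd w \<notin> S"
    by (auto simp: fusing_def S_def)
  have mk: "x i j \<in> S \<longleftrightarrow> mk i" for i j
  proof (induction j rule: int_induct[where k = 0])
    case base
    then show ?case by (simp add: mk_def)
  next
    case (step1 j)
    with W3[OF tilingsD(2)[OF x, of i j]] show ?case by simp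
  next
    case (step2 j)
    with W3[OF tilingsD(2)[OF x, of i "j - 1"]] show ?case by simp
  qed
  \<comment> \<open>A marker and its left neighbor form a word, and no word starts with a
    marker.\<close>
  have isolated: "\<not> mk i" if "mk (i + 1)" for i
    using W4[OF W1[OF tilingsD(1)[OF x, of i 0]]] that mk by force
  define next_col where "next_col i = (if mk (i + 1) then i + 2 else i + 1)" for i
  have next1: "\<not> mk (next_col i)" for i
    using isolated[of "i + 1"] by (auto simp: next_col_def add.commute)
  have next2: "\<exists>j. \<not> mk j \<and> next_col j = i" if "\<not> mk i" for i
  proof (cases "mk (i - 1)")
    case True
    with isolated[of "i - 2"] show ?thesis
      by (intro exI[of _ "i - 2"]) (auto simp: next_col_def)
  next
    case False
    with that show ?thesis
      by (intro exI[of _ "i - 1"]) (auto simp: next_col_def)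
  qed
  have "\<exists>i. \<not> mk i"
    using isolated[of 0] by auto
  then obtain i0 where "\<not> mk i0" ..
  then have "\<exists>p :: int \<Rightarrow> int. \<forall>k. \<not> mk (p k) \<and> p (k + 1) = next_col (p k)"
    by (rule ex_biinfinite_orbit) (rule next1, rule next2)
  then obtain p :: "int \<Rightarrow> int" where "\<forall>k. \<not> mk (p k) \<and> p (k + 1) = next_col (p k)" ..
  then have p: "\<not> mk (p k)" "p (k + 1) = next_col (p k)" for k
    by simp_all
  define word where
    "word k j = (if mk (p k + 1) then [x (p k) j, x (p k + 1) j] else [x (p k) j])" for k j
  have word: "word k j \<in> set W" for k j
    using W1[OF tilingsD(1)[OF x, of "p k" j]] W2[OF tilingsD(1)[OF x, of "p k" j]] p(1)[of k]
    by (auto simp: word_def mk)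
  then have "\<exists>a. a < length W \<and> W ! a = word k j" for k j
    by (simp add: in_set_conv_nth)
  then obtain y where y: "\<And>k j. y k j < length W" "\<And>k j. W ! y k j = word k j"
    by metis
  have "inflates W p y x"
    by (auto simp: inflates_def y word_def p(2) next_col_def less_Suc_eq)
  moreover have "lift_h W h (y k j) (y (k + 1) j)" for k j
    using tilingsD(1)[OF x, of "p k" j] tilingsD(1)[OF x, of "p k + 1" j]
    by (auto simp: lift_h_def y word_def p(2) next_col_def add.assoc)
  moreover have "lift_v W v (y k j) (y k (j + 1))" for k j
    using tilingsD(2)[OF x, of _ j]
    by (auto simp: lift_v_def y word_def)
  ultimately show ?thesis
    by (intro bexI[of _ y] exI[of _ p]) (auto simp: tilings_def)
qed

section \<open>Positions of columns and letters in an inflation\<close>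

context
  fixes W p y x
  assumes inflates: "inflates W p y x"
begin

lemma inflates_width:
  shows "length (W ! y k j) = 1 \<or> length (W ! y k j) = 2"
    and "p (k + 1) = p k + int (length (W ! y k j))"
  using inflates by (auto simp: inflates_def)

lemma inflates_step: "p k + 1 \<le> p (k + 1)" "p (k + 1) \<le> p k + 2"
  using inflates_width[of k 0] by auto

lemma inflates_diff: "k \<le> m \<Longrightarrow> m - k \<le> p m - p k"
proof (induction m rule: int_ge_induct)
  case (step m)
  with inflates_step(1)[of m] show ?case by simp
qed simp

lemma inflates_locate: obtains k where "p k \<le> i" "i < p (k + 1)"
proof -
  \<comment> \<open>As \<open>p\<close> advances by at least one per column, these two columns lie
    on either side of \<open>i\<close>.\<close>
  define k0 where "k0 = - \<bar>p 0\<bar> - \<bar>i\<bar>"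
  define k1 where "k1 = \<bar>p 0\<bar> + \<bar>i\<bar> + 1"
  have "k0 \<le> 0" "0 \<le> k1"
    by (simp_all add: k0_def k1_def)
  from this[THEN inflates_diff] have k0: "p k0 \<le> i" and k1: "i < p k1"
    unfolding k0_def k1_def by linarith+
  have "k0 \<le> k1"
    by (simp add: k0_def k1_def)
  from this k1 have "\<exists>k. p k \<le> i \<and> i < p (k + 1)"
  proof (induction k1 rule: int_ge_induct)
    case (step m)
    then show ?case by (cases "i < p m") (auto simp: not_less)
  qed (use k0 in simp)
  with that show ?thesis by blast
qed

lemma inflates_letter:
  assumes "p k \<le> i" "i < p (k + 1)"
  shows "nat (i - p k) < length (W ! y k j)" and "x i j = W ! y k j ! nat (i - p k)"
proof -
  show "nat (i - p k) < length (W ! y k j)"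
    using assms inflates_width(2)[of k j] by auto
  moreover have "\<forall>r < length (W ! y k j). x (p k + int r) j = W ! y k j ! r"
    using inflates by (simp add: inflates_def)
  ultimately have "x (p k + int (nat (i - p k))) j = W ! y k j ! nat (i - p k)"
    by blast
  with assms show "x i j = W ! y k j ! nat (i - p k)"
    by simp
qed

lemma inflates_first: "x (p k) j = W ! y k j ! 0" "W ! y k j \<in> set W"
  using inflates_letter(2)[of k "p k" j] inflates_step[of k] inflates
  by (auto simp: inflates_def)

end

section \<open>Recurrence of windows\<close>

definition matches ::
    "nat \<Rightarrow> nat \<Rightarrow> (int \<Rightarrow> int \<Rightarrow> nat) \<Rightarrow> int \<Rightarrow> int \<Rightarrow> (int \<Rightarrow> int \<Rightarrow> nat) \<Rightarrow> int \<Rightarrow> int \<Rightarrow> bool" where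
  "matches n m x a b z c d \<longleftrightarrow>
     (\<forall>i < n. \<forall>j < m. x (a + int i) (b + int j) = z (c + int i) (d + int j))"

definition recurs :: "nat \<Rightarrow> nat \<Rightarrow> (int \<Rightarrow> int \<Rightarrow> nat) set \<Rightarrow> bool" where
  "recurs n m X \<longleftrightarrow> (\<forall>x\<in>X. \<forall>z\<in>X. \<forall>a b. \<exists>c d. matches n m x a b z c d)"

definition desub ::
    "nat list list \<Rightarrow> (int \<Rightarrow> int \<Rightarrow> nat) set \<Rightarrow> (int \<Rightarrow> int \<Rightarrow> nat) set \<Rightarrow> bool" where
  "desub W X Y \<longleftrightarrow> (\<forall>x\<in>X. \<exists>y\<in>Y. \<exists>p. inflates W p y x)"

lemma matches_flip: "matches n m (flip x) a b (flip z) c d \<longleftrightarrow> matches m n x b a z d c"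
  by (auto simp: matches_def)

lemma recurs_flip: "recurs n m (flip ` X) \<longleftrightarrow> recurs m n X"
  by (fastforce simp: recurs_def matches_flip)

text \<open>Letters determine the widths of their columns, so along matching windows
  \<open>p\<close> and \<open>q\<close> advance alike and the inflated windows agree cell by
  cell.\<close>

lemma matches_inflate:
  assumes x: "inflates W p y x" and z: "inflates W q y' z"
    and match: "matches n m y k b y' c d"
    and a: "p k \<le> a" "a + int N \<le> p (k + int n)"
  shows "matches N m x a b z (q c + (a - p k)) d"
  unfolding matches_def
proof (intro allI impI)
  fix i j assume i: "i < N" and j: "j < m"
  have eq: "y (k + int t) (b + int j') = y' (c + int t) (d + int j')" if "t < n" "j' < m" for t j'
    using match that by (auto simp: matches_def)
  have q: "q (c + int t) - q c = p (k + int t) - p k" if "t \<le> n" for t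
    using that
  proof (induction t)
    case (Suc t)
    then have "t < n" by simp
    from eq[OF this j] inflates_width(2)[OF x, of "k + int t" "b + int j"]
      inflates_width(2)[OF z, of "c + int t" "d + int j"] Suc
    show ?case by (simp add: ac_simps)
  qed simp
  obtain l where l: "p l \<le> a + int i" "a + int i < p (l + 1)"
    by (rule inflates_locate[OF x])
  have "k \<le> l"
  proof (rule ccontr)
    assume "\<not> k \<le> l"
    with inflates_diff[OF x, of "l + 1" k] a(1) l(2) show False by simp
  qed
  moreover have "l < k + int n"
  proof (rule ccontr)
    assume "\<not> l < k + int n"
    with inflates_diff[OF x, of "k + int n" l] a(2) l(1) i show False by simp
  qed
  ultimately obtain t where t: "l = k + int t" "t < n"
    by (metis add_less_cancel_left nonneg_eq_int of_nat_less_iff zle_iff_zadd)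
  have q1: "q (c + int t + 1) - q c = p (l + 1) - p k"
    using q[of "Suc t"] t by (simp add: ac_simps)
  have q0: "q (c + int t) - q c = p l - p k"
    using q[of t] t by simp
  have "x (a + int i) (b + int j) = W ! y l (b + int j) ! nat (a + int i - p l)"
    by (rule inflates_letter(2)[OF x l])
  also have "\<dots> = W ! y' (c + int t) (d + int j) ! nat (q c + (a - p k) + int i - q (c + int t))"
    using eq[OF t(2) j] q0 t(1) by (simp add: algebra_simps)
  also have "\<dots> = z (q c + (a - p k) + int i) (d + int j)"
    by (rule inflates_letter(2)[OF z, symmetric]) (use l q0 q1 in simp_all)
  finally show "x (a + int i) (b + int j) = z (q c + (a - p k) + int i) (d + int j)" .
qed

lemma ex_match_inflate:
  assumes "inflates W p y x" and "y \<in> Y" and "z \<in> X" and "desub W X Y" and "recurs n m Y"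
    and "p k \<le> a" "a + int N \<le> p (k + int n)"
  shows "\<exists>c d. matches N m x a b z c d"
proof -
  obtain y' q where "y' \<in> Y" "inflates W q y' z"
    using assms(3,4) by (auto simp: desub_def)
  with matches_inflate[OF assms(1) this(2) _ assms(6,7)] assms(2,5) show ?thesis
    by (meson recurs_def)
qed

text \<open>Windows do not grow here: starting with the column that contains the left edge,
  \<open>n\<close> columns cover width \<open>n\<close> even if each contributes a single
  cell.\<close>

lemma recurs_desub:
  assumes "desub W X Y" and "recurs n m Y"
  shows "recurs n m X"
  unfolding recurs_def
proof (intro ballI allI)
  fix x z a b assume "x \<in> X" "z \<in> X"
  with assms(1) obtain y p where y: "y \<in> Y" "inflates W p y x"
    by (auto simp: desub_def)
  obtain k where k: "p k \<le> a" "a < p (k + 1)"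
    by (rule inflates_locate[OF y(2)])
  show "\<exists>c d. matches n m x a b z c d"
  proof (cases "n = 0")
    case False
    then have "a + int n \<le> p (k + int n)"
      using inflates_diff[OF y(2), of "k + 1" "k + int n"] k by auto
    from ex_match_inflate[OF y(2,1) \<open>z \<in> X\<close> assms k(1) this] show ?thesis .
  qed (simp add: matches_def)
qed

definition expanding :: "nat list list \<Rightarrow> (nat \<Rightarrow> nat \<Rightarrow> bool) \<Rightarrow> bool" where
  "expanding W h \<longleftrightarrow> (\<forall>a b. h a b \<longrightarrow> length (W ! a) \<noteq> 1 \<or> length (W ! b) \<noteq> 1)"

text \<open>The column of the left edge may contribute one cell only, but the two after it
  contribute at least three. This is why \<open>n\<close> must be at least 3.\<close>

lemma recurs_desub_expanding:
  assumes "desub W X (tilings h v)" and "expanding W h" and "recurs n m (tilings h v)" and "3 \<le> n"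
  shows "recurs (Suc n) m X"
  unfolding recurs_def
proof (intro ballI allI)
  fix x z a b assume "x \<in> X" "z \<in> X"
  with assms(1) obtain y p where y: "y \<in> tilings h v" "inflates W p y x"
    by (auto simp: desub_def)
  obtain k where k: "p k \<le> a" "a < p (k + 1)"
    by (rule inflates_locate[OF y(2)])
  have "length (W ! y (k + 1) 0) \<noteq> 1 \<or> length (W ! y (k + 1 + 1) 0) \<noteq> 1"
    using assms(2) tilingsD(1)[OF y(1)] unfolding expanding_def by blast
  then have "p (k + 1) + 3 \<le> p (k + 3)"
    using inflates_width[OF y(2), of "k + 1" 0] inflates_width[OF y(2), of "k + 1 + 1" 0]
    by (auto simp: add.assoc)
  then have "a + int (Suc n) \<le> p (k + int n)"
    using inflates_diff[OF y(2), of "k + 3" "k + int n"] k assms(4) by auto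
  from ex_match_inflate[OF y(2,1) \<open>z \<in> X\<close> assms(1,3) k(1) this]
  show "\<exists>c d. matches (Suc n) m x a b z c d" .
qed

text \<open>
  A window of width three covers three columns of its desubstitution only if the middle one is
  not fused; by the last assumption this cannot happen on two consecutive levels.
\<close>

lemma recurs_desub_three:
  assumes X: "desub W X Y" and Y: "desub V (flip ` Y) (flip ` X)" and "recurs 2 m Y" and "0 < m"
    and single: "\<And>s u. s < length W \<Longrightarrow> length (W ! s) = 1 \<Longrightarrow> u \<in> set (V ! (W ! s ! 0)) \<Longrightarrow>
                   length (W ! u) \<noteq> 1"
  shows "recurs 3 m X"
  unfolding recurs_def
proof (intro ballI allI)
  \<comment> \<open>In the second case three columns are required: the first contributes its last
    cell and the middle one is a single column.\<close>
  have cover: "(\<exists>k. p k \<le> a \<and> a + 3 \<le> p (k + 2)) \<or>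
      (\<exists>k. p k \<le> a \<and> a + 3 \<le> p (k + 3) \<and> p (k + 1) = a + 1 \<and>
         (\<forall>j. length (W ! y (k + 1) j) = 1))"
    if inf: "inflates W p y x" for p y x a
  proof -
    obtain k where k: "p k \<le> a" "a < p (k + 1)"
      by (rule inflates_locate[OF inf])
    show ?thesis
    proof (cases "a + 3 \<le> p (k + 2)")
      case False
      then have "p (k + 1) = a + 1" "p (k + 1 + 1) = p (k + 1) + 1"
        using k inflates_step[OF inf, of "k + 1"] by (auto simp: add.assoc)
      moreover have "length (W ! y (k + 1) j) = 1" for j
        using calculation inflates_width(2)[OF inf, of "k + 1" j] by simp
      moreover have "a + 3 \<le> p (k + 3)"
        using calculation inflates_step[OF inf, of "k + 2"] by (simp add: add.assoc)
      ultimately show ?thesis using k by blast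
    qed (use k in blast)
  qed
  fix x z a b assume x: "x \<in> X" and z: "z \<in> X"
  from X x obtain y p where y: "y \<in> Y" "inflates W p y x" by (auto simp: desub_def)
  from X z obtain z' q where z': "z' \<in> Y" "inflates W q z' z" by (auto simp: desub_def)
  from cover[OF y(2), of a] show "\<exists>c d. matches 3 m x a b z c d"
  proof (elim disjE exE conjE)
    fix k assume "p k \<le> a" "a + 3 \<le> p (k + 2)"
    with ex_match_inflate[OF y(2,1) z X assms(3), of k a 3] show ?thesis by simp
  next
    fix k assume k: "p k \<le> a" "a + 3 \<le> p (k + 3)" "\<forall>j. length (W ! y (k + 1) j) = 1"
    \<comment> \<open>The vertical fusion leaves columns in place, so the three columns of
      \<open>y\<close> come from the same three columns of \<open>x'\<close>. Matching a window of
      \<open>x'\<close> that needs only two columns one level further up is then enough.\<close>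
    from Y y(1) obtain x' p' where x': "x' \<in> X" "inflates V p' (flip x') (flip y)"
      by (auto simp: desub_def)
    from Y z'(1) obtain z'' q' where z'': "z'' \<in> X" "inflates V q' (flip z'') (flip z')"
      by (auto simp: desub_def)
    obtain l where l: "p' l \<le> b" "b < p' (l + 1)"
      by (rule inflates_locate[OF x'(2)])
    have "b + int m \<le> p' (l + int m)"
      using inflates_diff[OF x'(2), of "l + 1" "l + int m"] l \<open>0 < m\<close> by auto
    note transfer = matches_inflate[OF x'(2) z''(2) _ l(1) this, of 3 k]
    from X x'(1) obtain w r where w: "w \<in> Y" "inflates W r w x'" by (auto simp: desub_def)
    from cover[OF w(2), of k] show ?thesis
    proof (elim disjE exE conjE)
      fix s assume "r s \<le> k" "k + 3 \<le> r (s + 2)"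
      with ex_match_inflate[OF w(2,1) z''(1) X assms(3), of s k 3 l]
      obtain c d where "matches 3 m x' k l z'' c d" by auto
      then have "\<exists>d. matches 3 m y k b z' c d"
        using transfer[of d c] by (auto simp: matches_flip)
      with matches_inflate[OF y(2) z'(2), of 3 m k b c _ a 3] k show ?thesis by auto
    next
      fix s assume s: "r (s + 1) = k + 1" "\<forall>j. length (W ! w (s + 1) j) = 1"
      \<comment> \<open>The remaining case is contradictory: the middle letter of \<open>y\<close>
        stands alone and lies in the vertical word of a letter that itself arises from a word of
        length 1.\<close>
      have "y (k + 1) b \<in> set (V ! x' (k + 1) l)"
        using inflates_letter[OF x'(2) l, of "k + 1"] by simp
      moreover have "x' (k + 1) l = W ! w (s + 1) l ! 0"
        using inflates_first(1)[OF w(2), of "s + 1" l] s by simp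
      moreover have "w (s + 1) l < length W"
        using w(2) by (simp add: inflates_def)
      ultimately show ?thesis
        using single[of "w (s + 1) l" "y (k + 1) b"] s(2) k(3) by auto
    qed
  qed
qed

section \<open>Periods\<close>

definition period :: "(int \<Rightarrow> int \<Rightarrow> nat) \<Rightarrow> int \<Rightarrow> int \<Rightarrow> bool" where
  "period x a b \<longleftrightarrow> (\<forall>i j. x (i + a) (j + b) = x i j)"

definition no_periods :: "(int \<Rightarrow> int \<Rightarrow> nat) set \<Rightarrow> bool" where
  "no_periods X \<longleftrightarrow> (\<forall>x\<in>X. \<forall>a b. period x a b \<longrightarrow> a = 0 \<and> b = 0)"

lemma period_flip [simp]: "period (flip x) a b \<longleftrightarrow> period x b a"
  by (auto simp: period_def)

lemma no_periods_flip: "no_periods (flip ` X) \<longleftrightarrow> no_periods X"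
  by (auto simp: no_periods_def)

text \<open>The range of \<open>p\<close> can be read off from \<open>x\<close>: it consists of the
  unmarked columns. A period of \<open>x\<close> therefore permutes these positions, and
  \<bar>a'\<bar> counts the columns in a stretch of length \<bar>a\<bar>; the count is smaller than
  the length as soon as a fused column exists.\<close>

lemma period_desubstitution:
  assumes inf: "inflates W p y x" and per: "period x a b"
    and W: "distinct W" "\<And>w. w \<in> set W \<Longrightarrow> hd w \<notin> seconds W"
  obtains a' where "period y a' b" "a' = 0 \<longleftrightarrow> a = 0" "\<bar>a'\<bar> \<le> \<bar>a\<bar>"
    "a \<noteq> 0 \<Longrightarrow> \<exists>k j. length (W ! y k j) \<noteq> 1 \<Longrightarrow> \<bar>a'\<bar> < \<bar>a\<bar>"
proof -
  have first: "x (p k) j \<notin> seconds W" for k j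
    using inflates_first[OF inf, of k j] inflates_width(1)[OF inf, of k j] W(2)
    by (metis hd_conv_nth length_0_conv one_neq_zero zero_neq_numeral)
  have range: "i \<in> range p" if "x i j \<notin> seconds W" for i j
  proof -
    obtain k where k: "p k \<le> i" "i < p (k + 1)"
      by (rule inflates_locate[OF inf])
    show ?thesis
    proof (cases "i = p k")
      case False
      with k inflates_step[OF inf, of k] have "i = p k + 1" by simp
      with inflates_letter[OF inf k, of j] inflates_width(1)[OF inf, of k j]
      have "length (W ! y k j) = 2" "x i j = W ! y k j ! 1" by auto
      then have "x i j \<in> set (tl (W ! y k j))"
        by (cases "W ! y k j") (auto simp: length_Suc_conv)
      with inflates_first(2)[OF inf, of k j] that show ?thesis
        by (auto simp: seconds_def)
    qed simp
  qed
  have inj: "k = l" if "p k = p l" for k l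
    using inflates_diff[OF inf, of k l] inflates_diff[OF inf, of l k] that by linarith
  have next_eq: "p (k + 1) = p k + (if x (p k + 1) j \<in> seconds W then 2 else 1)" for k j
  proof (cases "x (p k + 1) j \<in> seconds W")
    case True
    then have "p (k + 1) \<noteq> p k + 1"
      using first[of "k + 1" j] by auto
    with True inflates_step[OF inf, of k] show ?thesis by simp
  next
    case False
    from range[OF this] obtain l where l: "p l = p k + 1" by force
    then have "l = k + 1"
      using inflates_diff[OF inf, of l k] inflates_diff[OF inf, of "k + 1" l]
        inflates_step[OF inf, of k] by (cases "l \<le> k") auto
    with l False show ?thesis by simp
  qed
  have x_shift: "x (i + a) (j + b) = x i j" for i j
    using per by (simp add: period_def)
  have "x (p 0 + a) (0 + b) \<notin> seconds W"
    unfolding x_shift by (rule first)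
  from range[OF this] obtain a' where a': "p a' = p 0 + a" by force
  have p_shift: "p (k + a') = p k + a" for k
  proof (induction k rule: int_induct[where k = 0])
    case base
    show ?case using a' by simp
  next
    case (step1 k)
    have "p (k + 1 + a') = p (k + a' + 1)" by (simp add: ac_simps)
    also have "\<dots> = p k + a + (if x (p k + a + 1) (0 + b) \<in> seconds W then 2 else 1)"
      using next_eq[of "k + a'" "0 + b"] step1 by simp
    also have "x (p k + a + 1) (0 + b) = x (p k + 1) 0"
      using x_shift[of "p k + 1" 0] by (simp add: ac_simps)
    finally show ?case using next_eq[of k 0] by simp
  next
    \<comment> \<open>\<open>next_eq\<close> only leads to the right. To go left, the column
      \<open>l\<close> at the shifted position is found first and then identified by injectivity of
      \<open>p\<close>.\<close>
    case (step2 k)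
    have "x (p (k - 1) + a) (0 + b) \<notin> seconds W"
      using x_shift[of "p (k - 1)" 0] first by simp
    from range[OF this] obtain l where l: "p l = p (k - 1) + a" by force
    have "x (p l + 1) (0 + b) = x (p (k - 1) + 1) 0"
      using x_shift[of "p (k - 1) + 1" 0] l by (simp add: ac_simps)
    then have "p (l + 1) = p k + a"
      using next_eq[of l "0 + b"] next_eq[of "k - 1" 0] l by simp
    then have "l + 1 = k + a'"
      using step2 inj by simp
    then have "k - 1 + a' = l" by simp
    with l show ?case by simp
  qed
  have "y (k + a') (j + b) = y k j" for k j
  proof -
    have len: "length (W ! y (k + a') (j + b)) = length (W ! y k j)"
      using inflates_width(2)[OF inf, of "k + a'" "j + b"] inflates_width(2)[OF inf, of k j]
        p_shift[of k] p_shift[of "k + 1"] by (simp add: ac_simps)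
    have "W ! y (k + a') (j + b) = W ! y k j"
    proof (rule nth_equalityI[OF len])
      fix r assume "r < length (W ! y (k + a') (j + b))"
      with len inf have "W ! y (k + a') (j + b) ! r = x (p (k + a') + int r) (j + b)"
        "W ! y k j ! r = x (p k + int r) j"
        by (auto simp: inflates_def)
      then show "W ! y (k + a') (j + b) ! r = W ! y k j ! r"
        using x_shift[of "p k + int r" j] p_shift[of k] by (simp add: ac_simps)
    qed
    with W(1) inf show ?thesis
      by (simp add: inflates_def nth_eq_iff_index_eq)
  qed
  then have "period y a' b"
    by (simp add: period_def)
  moreover have "a' = 0 \<longleftrightarrow> a = 0"
    using a' inj[of a' 0] by auto
  moreover have "\<bar>a'\<bar> \<le> \<bar>a\<bar>"
    using a' inflates_diff[OF inf, of 0 a'] inflates_diff[OF inf, of a' 0] by linarith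
  moreover have "\<bar>a'\<bar> < \<bar>a\<bar>" if "a \<noteq> 0" and "\<exists>k j. length (W ! y k j) \<noteq> 1"
  proof -
    from that(2) obtain k where k: "p (k + 1) = p k + 2"
      using inflates_width[OF inf] by (metis of_nat_numeral)
    \<comment> \<open>Any \<bar>a'\<bar> consecutive columns have total width \<bar>a\<bar>; the
      block is chosen so that it contains the fused column \<open>k\<close>.\<close>
    show ?thesis
    proof (cases "0 < a'")
      case True
      then show ?thesis
        using inflates_diff[OF inf, of "k + 1" "k + a'"] k p_shift[of k] by linarith
    next
      case False
      with that(1) \<open>a' = 0 \<longleftrightarrow> a = 0\<close> have "a' < 0" by simp
      then show ?thesis
        using inflates_diff[OF inf, of "k + 1 + a'" k] k p_shift[of "k + 1"] by linarith
    qed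
  qed
  ultimately show ?thesis
    by (rule that)
qed

section \<open>Existence of tilings\<close>

text \<open>The bound \<open>l\<close> keeps the alphabet finite, as the later compactness argument
  requires.\<close>

definition patch ::
    "nat \<Rightarrow> (nat \<Rightarrow> nat \<Rightarrow> bool) \<Rightarrow> (nat \<Rightarrow> nat \<Rightarrow> bool) \<Rightarrow> nat \<Rightarrow> nat \<Rightarrow> (nat \<Rightarrow> nat \<Rightarrow> nat) \<Rightarrow> bool" where
  "patch l h v n m x \<longleftrightarrow>
     (\<forall>i < n. \<forall>j < m. x i j < l \<and>
        (Suc i < n \<longrightarrow> h (x i j) (x (Suc i) j)) \<and> (Suc j < m \<longrightarrow> v (x i j) (x i (Suc j))))"

definition inflatable ::
    "nat list list \<Rightarrow> (nat \<Rightarrow> nat \<Rightarrow> bool) \<Rightarrow> (nat \<Rightarrow> nat \<Rightarrow> bool) \<Rightarrow>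
     (nat \<Rightarrow> nat \<Rightarrow> bool) \<Rightarrow> (nat \<Rightarrow> nat \<Rightarrow> bool) \<Rightarrow> bool" where
  "inflatable W h v h' v' \<longleftrightarrow>
     (\<forall>w\<in>set W. w \<noteq> [] \<and> successively h w) \<and>
     (\<forall>a b. h' a b \<longrightarrow> h (last (W ! a)) (hd (W ! b))) \<and>
     (\<forall>a b. v' a b \<longrightarrow> list_all2 v (W ! a) (W ! b))"

lemma patch_flip: "patch l h v n m (flip x) \<longleftrightarrow> patch l v h m n x"
  by (auto simp: patch_def)

lemma patch_mono: "patch l h v n m x \<Longrightarrow> n' \<le> n \<Longrightarrow> m' \<le> m \<Longrightarrow> patch l h v n' m' x"
  unfolding patch_def by (meson less_le_trans)

lemma successively_concat_upt:
  assumes "\<And>k. k < n \<Longrightarrow> f k \<noteq> [] \<and> successively h (f k)"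
    and "\<And>k. Suc k < n \<Longrightarrow> h (last (f k)) (hd (f (Suc k)))"
  shows "successively h (concat (map f [0..<n]))"
  using assms
proof (induction n)
  case (Suc n)
  then have "successively h (concat (map f [0..<n]))" by simp
  moreover have "h (last (concat (map f [0..<n]))) (hd (f n))" if "n \<noteq> 0"
  proof -
    from that obtain k where "n = Suc k" using not0_implies_Suc by blast
    with Suc.prems show ?thesis by simp
  qed
  ultimately show ?case
    using Suc.prems(1)[of n] by (cases "n = 0") (auto simp: successively_append_iff)
qed simp

lemma list_all2_concat_upt:
  assumes "\<And>k. k < n \<Longrightarrow> list_all2 v (f k) (g k)"
  shows "list_all2 v (concat (map f [0..<n])) (concat (map g [0..<n]))"
  using assms by (induction n) (auto intro: list_all2_appendI)

lemma length_concat_upt: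
  assumes "\<And>k. k < n \<Longrightarrow> f k \<noteq> []"
  shows "n \<le> length (concat (map f [0..<n]))"
    and "k < n \<Longrightarrow> length (f k) \<noteq> 1 \<Longrightarrow> n < length (concat (map f [0..<n]))"
proof -
  have ge: "Suc 0 \<le> length (f k)" if "k < n" for k
    using assms[OF that] by (cases "f k") auto
  have len: "length (concat (map f [0..<n])) = (\<Sum>k<n. length (f k))"
    by (induction n) auto
  have "(\<Sum>k<n. 1) \<le> (\<Sum>k<n. length (f k))"
    using ge by (intro sum_mono) simp
  with len show "n \<le> length (concat (map f [0..<n]))" by simp
  assume k: "k < n" "length (f k) \<noteq> 1"
  have "(\<Sum>k<n. 1) < (\<Sum>k<n. length (f k))"
    using ge ge[OF k(1)] k by (intro sum_strict_mono_ex1) (auto intro!: bexI[of _ k] le_neq_trans)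
  with len show "n < length (concat (map f [0..<n]))" by simp
qed

text \<open>Each row is inflated by concatenating its words. All rows get the same length, since
  vertically adjacent letters have words of equal length.\<close>

lemma patch_inflate:
  assumes y: "patch (length W) h' v' n m y" and W: "inflatable W h v h' v'"
    and l: "\<And>w a. w \<in> set W \<Longrightarrow> a \<in> set w \<Longrightarrow> a < l"
    and ne: "\<forall>k < n. \<forall>j < m. W ! y k j \<noteq> []" and "0 < m"
  obtains n' x where "patch l h v n' m x" "n \<le> n'"
    "\<forall>k < n. length (W ! y k 0) \<noteq> 1 \<longrightarrow> n < n'"
proof -
  define row where "row j = concat (map (\<lambda>k. W ! y k j) [0..<n])" for j
  have W_in: "W ! y k j \<in> set W" if "k < n" "j < m" for k j
    using y that by (simp add: patch_def)
  have h: "successively h (row j)" if "j < m" for j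
    unfolding row_def
  proof (rule successively_concat_upt)
    fix k assume "k < n"
    with W_in[OF this that] W show "W ! y k j \<noteq> [] \<and> successively h (W ! y k j)"
      by (simp add: inflatable_def)
  next
    fix k assume "Suc k < n"
    with y that have "h' (y k j) (y (Suc k) j)" by (simp add: patch_def)
    with W show "h (last (W ! y k j)) (hd (W ! y (Suc k) j))" by (simp add: inflatable_def)
  qed
  have v: "list_all2 v (row j) (row (Suc j))" if "Suc j < m" for j
    unfolding row_def
  proof (rule list_all2_concat_upt)
    fix k assume "k < n"
    with y that have "v' (y k j) (y k (Suc j))" by (simp add: patch_def)
    with W show "list_all2 v (W ! y k j) (W ! y k (Suc j))" by (simp add: inflatable_def)
  qed
  have len: "length (row j) = length (row 0)" if "j < m" for j
    using that
  proof (induction j)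
    case (Suc j)
    with v[THEN list_all2_lengthD, of j] show ?case by simp
  qed simp
  have in_row: "a < l" if "a \<in> set (row j)" "j < m" for a j
  proof -
    from that obtain k where "k < n" "a \<in> set (W ! y k j)"
      by (auto simp: row_def)
    with l[OF W_in] that(2) show ?thesis by blast
  qed
  have "patch l h v (length (row 0)) m (\<lambda>i j. row j ! i)"
    unfolding patch_def
  proof (intro allI impI conjI)
    fix i j assume i: "i < length (row 0)" and j: "j < m"
    show "row j ! i < l"
      using in_row[OF nth_mem j] i len[OF j] by simp
    show "h (row j ! i) (row j ! Suc i)" if "Suc i < length (row 0)"
      using h[OF j] that len[OF j] by (simp add: successively_conv_nth)
    show "v (row j ! i) (row (Suc j) ! i)" if "Suc j < m"
      using v[OF that] i len[OF j] by (simp add: list_all2_conv_all_nth)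
  qed
  then show ?thesis
  proof (rule that)
    show "n \<le> length (row 0)"
      unfolding row_def using ne \<open>0 < m\<close> by (intro length_concat_upt(1)) simp
    show "\<forall>k < n. length (W ! y k 0) \<noteq> 1 \<longrightarrow> n < length (row 0)"
    proof (intro allI impI)
      fix k assume "k < n" "length (W ! y k 0) \<noteq> 1"
      with ne \<open>0 < m\<close> show "n < length (row 0)"
        unfolding row_def by (intro length_concat_upt(2)[of n _ k]) simp_all
    qed
  qed
qed

text \<open>The configurations that respect the adjacencies on the centered square of radius
  \<open>n\<close> form a decreasing sequence of nonempty closed sets in a compact product space; a
  common point is a tiling.\<close>

lemma tiling_of_patches:
  assumes "\<And>n. \<exists>x. patch l h v n n x"
  shows "tilings h v \<noteq> {}"
proof -
  let ?T = "product_topology (\<lambda>_. discrete_topology {..<l}) (UNIV :: (int \<times> int) set)"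
  define R where "R n f \<longleftrightarrow> (\<forall>i j. - int n \<le> i \<and> i \<le> int n \<and> - int n \<le> j \<and> j \<le> int n \<longrightarrow>
      h (f (i, j)) (f (i + 1, j)) \<and> v (f (i, j)) (f (i, j + 1)))" for n and f :: "int \<times> int \<Rightarrow> nat"
  define C where "C n = {f \<in> topspace ?T. R n f}" for n
  have compact: "compact_space ?T"
    by (auto simp: compact_space_product_topology compact_space_discrete_topology)
  have closed1: "closedin ?T {f \<in> topspace ?T. r (f p) (f q)}"
    for r :: "nat \<Rightarrow> nat \<Rightarrow> bool" and p q
  proof -
    have "continuous_map ?T (prod_topology (discrete_topology {..<l}) (discrete_topology {..<l}))
            (\<lambda>f. (f p, f q))"
      by (intro continuous_map_pairedI continuous_map_product_projection) auto
    then have cont: "continuous_map ?T (discrete_topology ({..<l} \<times> {..<l})) (\<lambda>f. (f p, f q))"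
      by (simp add: prod_topology_discrete_topology)
    have eq: "{f \<in> topspace ?T. r (f p) (f q)} =
        {f \<in> topspace ?T. (f p, f q) \<in> {a \<in> {..<l} \<times> {..<l}. r (fst a) (snd a)}}"
      by (auto simp: PiE_def Pi_def simp del: split_paired_All)
    show ?thesis
      unfolding eq by (rule closedin_continuous_map_preimage[OF cont]) auto
  qed
  have closed: "closedin ?T (C n)" for n
  proof -
    have "C n = (\<Inter>q\<in>{- int n..int n} \<times> {- int n..int n}.
        {f \<in> topspace ?T. h (f q) (f (fst q + 1, snd q))} \<inter>
        {f \<in> topspace ?T. v (f q) (f (fst q, snd q + 1))})"
      unfolding C_def R_def by force
    moreover have "closedin ?T \<dots>"
      by (intro closedin_INT closedin_Int closed1) simp
    ultimately show ?thesis by simp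
  qed
  have nonempty: "C n \<noteq> {}" for n
  proof -
    obtain x where x: "patch l h v (2 * n + 2) (2 * n + 2) x"
      using assms by blast
    \<comment> \<open>Side \<open>2 * n + 2\<close> accounts for the coordinates from -n to n and
      for one more neighbor to the right and above. Elsewhere the index 0 only keeps the letter
      inside the alphabet.\<close>
    define g where "g i = (if - int n \<le> i \<and> i \<le> int n + 1 then nat (i + int n) else 0)" for i
    have g: "g i < 2 * n + 2" for i
      by (auto simp: g_def)
    have g_Suc: "g (i + 1) = Suc (g i)" if "- int n \<le> i" "i \<le> int n" for i
      using that by (auto simp: g_def nat_add_distrib[symmetric] Suc_nat_eq_nat_zadd1)
    have g_less: "g i < Suc (2 * n)" if "- int n \<le> i" "i \<le> int n" for i
      using that by (auto simp: g_def)
    have "(\<lambda>(i, j). x (g i) (g j)) \<in> C n"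
      using x g g_less by (auto simp: C_def R_def patch_def g_Suc PiE_def extensional_def)
    then show ?thesis by blast
  qed
  have "decseq C"
    by (rule antimonoI) (auto simp: C_def R_def)
  from compact_space_imp_nest[OF compact closed nonempty this]
  obtain f where f: "f \<in> (\<Inter>n. C n)" by blast
  have R: "R n f" for n
    using f by (auto simp: C_def)
  have "h (f (i, j)) (f (i + 1, j)) \<and> v (f (i, j)) (f (i, j + 1))" for i j
  proof -
    let ?n = "nat (\<bar>i\<bar> + \<bar>j\<bar>)"
    have "- int ?n \<le> i \<and> i \<le> int ?n \<and> - int ?n \<le> j \<and> j \<le> int ?n"
      by auto
    with R[of ?n] show ?thesis
      unfolding R_def by blast
  qed
  then have "(\<lambda>i j. f (i, j)) \<in> tilings h v"
    by (simp add: tilings_def)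
  then show ?thesis by blast
qed

lemma patch_of_tiling:
  assumes "tilings h v \<noteq> {}" and "\<And>a b. h a b \<Longrightarrow> a < l"
  shows "\<exists>x. patch l h v n m x"
proof -
  from assms(1) obtain x where x: "x \<in> tilings h v" by blast
  then have "patch l h v n m (\<lambda>i j. x (int i) (int j))"
    using tilingsD[OF x] assms(2)[OF tilingsD(1)[OF x]] by (auto simp: patch_def add.commute[of 1])
  then show ?thesis by blast
qed

lemma tilings_nonempty_inflate:
  assumes "tilings h' v' \<noteq> {}" and "inflatable W h v h' v'"
    and "\<And>a b. h' a b \<Longrightarrow> a < length W"
    and "\<And>w a. w \<in> set W \<Longrightarrow> a \<in> set w \<Longrightarrow> a < l"
  shows "tilings h v \<noteq> {}"
proof (rule tiling_of_patches)
  fix n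
  \<comment> \<open>With \<open>Suc n\<close> the height is positive, as
    \<open>patch_inflate\<close> demands.\<close>
  obtain y where y: "patch (length W) h' v' (Suc n) (Suc n) y"
    using patch_of_tiling[of h' v' "length W"] assms(1,3) by blast
  then have ne: "\<forall>k < Suc n. \<forall>j < Suc n. W ! y k j \<noteq> []"
    using assms(2) by (auto simp: patch_def inflatable_def)
  obtain n' x where "patch l h v n' (Suc n) x" "Suc n \<le> n'"
    by (rule patch_inflate[OF y assms(2,4) ne zero_less_Suc])
  then show "\<exists>x. patch l h v n n x"
    by (meson Suc_leD le_Suc_eq patch_mono)
qed

section \<open>Squares\<close>

type_synonym square = "nat \<times> nat \<times> nat \<times> nat"

definition square_at :: "(int \<Rightarrow> int \<Rightarrow> nat) \<Rightarrow> int \<Rightarrow> int \<Rightarrow> square" where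
  "square_at x i j = (x i j, x (i + 1) j, x i (j + 1), x (i + 1) (j + 1))"

fun flip_square :: "square \<Rightarrow> square" where
  "flip_square (a, b, c, d) = (a, c, b, d)"

fun squares_between :: "nat list \<Rightarrow> nat list \<Rightarrow> square list" where
  "squares_between (x # x' # xs) (y # y' # ys) = (x, x', y, y') # squares_between (x' # xs) (y' # ys)"
| "squares_between _ _ = []"

text \<open>A square lists its lower left, lower right, upper left and upper right letter. The
  result contains the squares inside a fused column as well as those across the seam.\<close>

fun inflate_square :: "nat list list \<Rightarrow> square \<Rightarrow> square list" where
  "inflate_square W (a, b, c, d) = squares_between (W ! a @ W ! b) (W ! c @ W ! d)"

lemma square_at_flip: "square_at (flip x) j i = flip_square (square_at x i j)"
  by (simp add: square_at_def)

lemma flip_square_flip [simp]: "flip_square (flip_square q) = q"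
  by (cases q) simp

lemma set_squares_between:
  "q \<in> set (squares_between xs ys) \<longleftrightarrow>
   (\<exists>r. Suc r < length xs \<and> Suc r < length ys \<and> q = (xs ! r, xs ! Suc r, ys ! r, ys ! Suc r))"
proof (induction xs ys rule: squares_between.induct)
  case (1 x x' xs y y' ys)
  have ex: "(\<exists>r. P r) \<longleftrightarrow> P 0 \<or> (\<exists>r. P (Suc r))" for P :: "nat \<Rightarrow> bool"
    by (metis not0_implies_Suc)
  show ?case
    by (subst ex) (simp add: 1)
qed auto

lemma inflates_letters:
  assumes "inflates W p y x" and "r < length (W ! y k j @ W ! y (k + 1) j)"
  shows "(W ! y k j @ W ! y (k + 1) j) ! r = x (p k + int r) j"
proof (cases "r < length (W ! y k j)")
  case True
  with assms(1) show ?thesis by (simp add: inflates_def nth_append)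
next
  case False
  moreover have "\<forall>r < length (W ! y (k + 1) j). x (p (k + 1) + int r) j = W ! y (k + 1) j ! r"
    using assms(1) by (simp add: inflates_def)
  moreover have "r - length (W ! y k j) < length (W ! y (k + 1) j)"
    using False assms(2) by simp
  ultimately have
    "x (p (k + 1) + int (r - length (W ! y k j))) j = W ! y (k + 1) j ! (r - length (W ! y k j))"
    by blast
  moreover have "p (k + 1) + int (r - length (W ! y k j)) = p k + int r"
    using False inflates_width(2)[OF assms(1), of k j] by simp
  ultimately have "x (p k + int r) j = W ! y (k + 1) j ! (r - length (W ! y k j))"
    by (simp only:)
  with False show ?thesis
    by (simp add: nth_append)
qed

lemma length_letters:
  assumes "inflates W p y x"
  shows "int (length (W ! y k j @ W ! y (k + 1) j)) = p (k + 1 + 1) - p k"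
  using inflates_width(2)[OF assms, of k j] inflates_width(2)[OF assms, of "k + 1" j] by simp

lemma inflate_square_iff:
  assumes "inflates W p y x"
  shows "q \<in> set (inflate_square W (square_at y k j)) \<longleftrightarrow>
    (\<exists>r. int r + 1 < p (k + 1 + 1) - p k \<and> q = square_at x (p k + int r) j)"
proof -
  have len: "int (length (W ! y k j' @ W ! y (k + 1) j')) = p (k + 1 + 1) - p k" for j'
    by (rule length_letters[OF assms])
  have "Suc r < length (W ! y k j' @ W ! y (k + 1) j') \<longleftrightarrow> int r + 1 < p (k + 1 + 1) - p k" for r j'
    unfolding len[of j', symmetric] by linarith
  moreover have "(W ! y k j' @ W ! y (k + 1) j') ! r = x (p k + int r) j'"
    "(W ! y k j' @ W ! y (k + 1) j') ! Suc r = x (p k + int r + 1) j'"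
    if "int r + 1 < p (k + 1 + 1) - p k" for r j'
    using that len[of j'] inflates_letters[OF assms, of r k j']
      inflates_letters[OF assms, of "Suc r" k j'] by (simp_all add: ac_simps)
  ultimately show ?thesis
    unfolding square_at_def inflate_square.simps set_squares_between by (metis (no_types, lifting))
qed

lemma ex_inflate_square:
  assumes "inflates W p y x"
  obtains k where "square_at x i j \<in> set (inflate_square W (square_at y k j))"
proof -
  obtain k where k: "p k \<le> i" "i < p (k + 1)"
    by (rule inflates_locate[OF assms])
  moreover have "p (k + 1) < p (k + 1 + 1)"
    using inflates_step[OF assms, of "k + 1"] by simp
  ultimately have "int (nat (i - p k)) + 1 < p (k + 1 + 1) - p k"
    "square_at x i j = square_at x (p k + int (nat (i - p k))) j"
    by simp_all
  with that[of k] show ?thesis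
    unfolding inflate_square_iff[OF assms] by blast
qed

section \<open>The levels\<close>

text \<open>
  The two further fusions below lead from the set of level 12 through one of level 13 back to
  level 12: the set of level 14 has the same color adjacencies, index by index.
\<close>

definition images12 :: "rule_image list" where
  "images12 =
     [Single 2, Single 3, Single 4, Single 12, Single 13, Single 14, Single 16, Single 17,
      Fused 2 0, Fused 3 1, Fused 4 1, Fused 5 1, Fused 12 7, Fused 13 6, Fused 14 6,
      Fused 14 8, Fused 15 11, Fused 16 9, Fused 16 10, Fused 17 7, Fused 18 10]"

definition images13 :: "rule_image list" where
  "images13 =
     [Single 7, Single 3, Single 18, Single 17, Single 19, Single 12, Fused 6 0, Fused 5 2,
      Fused 7 0, Fused 4 1, Fused 4 0, Fused 3 0, Fused 16 11, Fused 20 10, Fused 18 9,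
      Fused 17 8, Fused 14 10, Fused 15 10, Fused 13 9]"

text \<open>
  The successor lists of the adjacencies that survive pruning, for levels 5 to 13.
\<close>

definition h_lists :: "nat list list list" where
  "h_lists =
     [[[2, 10], [0], [11], [10], [12], [1, 9], [5], [4], [4], [8], [6, 7], [3], [3], [21],
      [22, 23, 27], [20], [15], [15], [14], [14], [19], [16, 18], [28], [13], [23, 27],
      [17, 19], [25], [26], [24]],
     [[2, 10], [0], [11], [10], [12], [1, 9], [5], [4], [4], [8], [6, 7], [3], [3], [21],
      [22, 23, 27], [20], [15], [15], [14], [14], [19], [16, 18], [28], [13], [23, 27],
      [17, 19], [25], [26], [24]],
     [[11], [10], [8, 9], [16], [13, 15], [19], [18], [0, 2], [1, 7], [12], [12], [2], [2], [3],
      [3], [5, 6, 17], [5, 6, 17], [4], [14, 16], [6, 17]],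
     [[7, 8], [11], [11], [18], [18], [13, 16, 17], [18], [10], [0, 9], [2], [0, 1], [0, 1, 9],
      [4], [4, 17], [6], [5], [6, 19], [5], [3, 12, 14, 15], [5]],
     [[8], [8], [5], [8], [1], [1], [3], [2], [0, 4, 6, 7], [20], [14], [17], [17, 19], [20],
      [9, 18], [13], [10, 11], [13, 21], [12], [10, 11], [15, 16], [12]],
     [[4, 6, 7], [14], [17], [10, 11, 12], [0, 8], [0], [0, 8], [5], [0], [3], [3], [1, 9],
      [2, 13], [3], [2, 13], [1], [2], [2, 13, 15, 16]],
     [[5], [8], [3], [1], [2], [1, 4], [0], [1], [1, 4, 6, 7], [18], [20], [13, 14, 15], [11],
      [11], [9, 12], [10, 17], [11], [11], [16], [9], [16, 19]],
     [[7], [7, 9, 10], [12], [17], [16], [16, 18], [1], [6], [1], [0, 8], [1, 11], [1],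
      [2, 13, 14], [2, 3], [4], [5], [2, 3, 14, 15], [2, 14], [4]],
     [[3], [7], [6], [0, 4, 5], [0, 1], [2], [0], [0, 5], [12], [19], [17, 18], [18, 20],
      [13, 14], [9], [10], [10], [11], [8, 15], [9, 16], [14], [10]]]"

definition v_lists :: "nat list list list" where
  "v_lists =
     [[[23], [14], [13], [16, 17, 18, 19, 23], [26, 28], [18, 19], [20, 21], [22], [27], [14],
      [13, 14, 15], [21], [24, 25], [1, 17, 19, 23], [6, 11, 12, 26, 28], [1, 18, 19], [20, 21],
      [5, 25], [2, 22], [4, 10, 27], [0, 14], [0, 13, 14, 15], [3, 24], [5, 24, 25], [6, 26],
      [6, 7, 8, 26], [9, 10, 27], [3, 5, 24], [10, 27]],
     [[13], [23], [21], [13, 14, 15], [24, 25], [14], [18, 19], [28], [26], [27], [20, 21, 22],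
      [16, 18], [17, 19, 23], [0, 13, 14, 15], [3, 5, 24, 25], [0, 14], [18, 19], [1, 19],
      [11, 28], [6, 12, 26], [10, 27], [2, 20, 21, 22], [10, 27], [1, 17, 19, 23], [5, 25],
      [4, 5, 25], [6, 7, 8, 26], [9, 10, 27], [6, 26]],
     [[4], [6], [3, 4, 5], [2, 6], [0, 3, 4, 5], [2, 6], [1, 2, 6], [17], [15, 16], [19], [18],
      [13, 15], [14, 16, 17], [15, 16], [7, 16], [11, 19], [8, 12, 18], [7, 14, 16, 17],
      [8, 9, 10, 18], [8, 18]],
     [[3, 4], [6], [5], [6], [0, 5], [0, 1, 2, 5], [0, 5], [18], [18], [15, 17], [12, 14],
      [13, 16, 18], [15, 17], [8, 17], [10, 19], [10, 19], [11], [9, 11], [7, 13, 16, 18], [9]],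
     [[13], [10, 11, 12], [12], [12], [16, 18], [19], [21], [21], [14, 17, 20], [0], [1, 9],
      [3, 13], [2, 10, 11, 12], [0, 1, 9], [8, 20], [4], [4, 6, 15], [5, 8, 14, 20], [7, 16],
      [5, 14, 17], [8, 20], [7, 16, 18]],
     [[1, 2, 3], [0, 3], [0, 1, 3], [0, 3], [11, 12, 14], [15, 16], [17], [17], [13], [8], [4],
      [4], [6, 10], [5, 8, 9], [7, 11], [5, 9], [13], [7, 11, 12, 14]],
     [[11], [9, 11], [11], [13], [12], [14], [12], [16, 17], [14, 15, 18], [1, 10], [1],
      [0, 1, 2, 9, 10, 11], [4, 16, 17], [3, 5, 14, 15], [3, 5, 15, 18], [8, 20], [6, 7, 19],
      [4, 16], [8, 20], [7], [8]],
     [[2], [2, 3, 4], [0, 3, 4], [1, 5], [1, 5], [1], [13], [12], [14], [12], [16, 17], [14],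
      [7, 16, 17], [6, 14, 15], [6, 8, 15], [11], [9, 10, 18], [7, 16], [10]],
     [[9, 10], [11], [11], [17, 18, 19], [14, 15, 16], [16], [20], [18], [0], [0, 8],
      [0, 1, 2, 8, 9, 10], [2, 10], [3], [4], [4, 13], [5, 14], [5, 14, 15], [3, 12],
      [6, 7, 17, 19], [3, 12], [6, 17, 18]]]"

definition level_images :: "nat \<Rightarrow> rule_image list" where
  "level_images i = (if i = 12 then images12 else if i = 13 then images13 else rule_images i)"

definition level_direction :: "nat \<Rightarrow> direction" where
  "level_direction i = (if i = 12 then Vertical else rule_direction i)"

definition level_tiles :: "nat \<Rightarrow> tile list" where
  "level_tiles i =
     (if i \<le> 12 then tile_list i
      else if i = 13 then map (image_tile Vertical (tile_list 12)) images12
      else map (image_tile Horizontal (map (image_tile Vertical (tile_list 12)) images12)) images13)"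

definition level_h :: "nat \<Rightarrow> nat list list" where
  "level_h i = h_lists ! ((if i = 14 then 12 else i) - 5)"

definition level_v :: "nat \<Rightarrow> nat list list" where
  "level_v i = v_lists ! ((if i = 14 then 12 else i) - 5)"

fun word :: "rule_image \<Rightarrow> nat list" where
  "word (Single u) = [u]"
| "word (Fused u v) = [u, v]"

definition level_words :: "nat \<Rightarrow> nat list list" where
  "level_words i = map word (level_images i)"

definition bounded :: "nat list list \<Rightarrow> bool" where
  "bounded A \<longleftrightarrow> list_all (\<lambda>bs. list_all (\<lambda>b. b < length A) bs) A"

definition refined :: "nat \<Rightarrow> bool" where
  "refined i \<longleftrightarrow>
     refine 5 (colour_matrix right_color left_color (level_tiles i))
              (colour_matrix top_color bottom_color (level_tiles i)) =
       (matrix (level_h i), matrix (level_v i)) \<and>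
     bounded (level_h i) \<and> bounded (level_v i)"

text \<open>This certifies the tables: five rounds of pruning, starting from the colors, produce
  exactly them.\<close>

lemma all_refined: "list_all refined [5..<14]"
  by code_simp

text \<open>Only the pattern of equal colors is compared; tilings by indices depend on nothing
  else.\<close>

lemma level_14:
  "colour_matrix right_color left_color (level_tiles 14) =
     colour_matrix right_color left_color (level_tiles 12) \<and>
   colour_matrix top_color bottom_color (level_tiles 14) =
     colour_matrix top_color bottom_color (level_tiles 12)"
  by code_simp

lemma refined_adjD:
  assumes "refined i"
  shows "adj (level_h i) a b \<Longrightarrow> h_adj (level_tiles i) a b"
    and "adj (level_v i) a b \<Longrightarrow> v_adj (level_tiles i) a b"
  using assms unfolding refined_def bounded_def by (blast dest: refined_adj_imp)+

section \<open>Executable conditions on the tables and their soundness\<close>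

definition edges :: "nat list list \<Rightarrow> (nat \<times> nat) list" where
  "edges A = concat (map (\<lambda>(a, bs). map (Pair a) bs) (zip [0..<length A] A))"

definition fusing_check :: "nat list list \<Rightarrow> nat list list \<Rightarrow> nat list list \<Rightarrow> nat list \<Rightarrow> bool" where
  "fusing_check W A B S \<longleftrightarrow>
     distinct W \<and> list_all (\<lambda>w. (length w = 1 \<or> length w = 2) \<and> \<not> List.member S (hd w)) W \<and>
     list_all (\<lambda>(a, b). if List.member S b then List.member W [a, b]
                        else List.member S a \<or> List.member W [a]) (edges A) \<and>
     list_all (\<lambda>(a, b). List.member S a = List.member S b) (edges B)"

definition inflatable_check ::
    "nat list list \<Rightarrow> nat list list \<Rightarrow> nat list list \<Rightarrow> nat list list \<Rightarrow> nat list list \<Rightarrow> bool" where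
  "inflatable_check W A B A' B' \<longleftrightarrow>
     list_all (\<lambda>w. w \<noteq> [] \<and> successively (adj A) w \<and> list_all (\<lambda>a. a < length A) w) W \<and>
     list_all (\<lambda>(a, b). adj A (last (W ! a)) (hd (W ! b))) (edges A') \<and>
     list_all (\<lambda>(a, b). list_all2 (adj B) (W ! a) (W ! b)) (edges B')"

definition level_check :: "nat \<Rightarrow> bool" where
  "level_check i \<longleftrightarrow>
     (let W = level_words i; A = level_h i; B = level_v i; A' = level_h (Suc i); B' = level_v (Suc i)
      in length A' = length W \<and> length B' = length W \<and>
         (if level_direction i = Horizontal
          then fusing_check W A B (concat (map tl W)) \<and> inflatable_check W A B A' B'
          else fusing_check W B A (concat (map tl W)) \<and> inflatable_check W B A B' A'))"

lemma all_level_check: "list_all level_check [6..<14]"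
  by code_simp

lemma adj_iff_edges: "adj A a b \<longleftrightarrow> (a, b) \<in> set (edges A)"
  by (force simp: adj_def edges_def set_zip)

lemma fusing_if_check:
  assumes "fusing_check W A B (concat (map tl W))"
  shows "fusing W (adj A) (adj B)"
proof -
  have S: "List.member (concat (map tl W)) a \<longleftrightarrow> a \<in> seconds W" for a
    by (simp add: seconds_def)
  show ?thesis
    using assms unfolding fusing_check_def fusing_def adj_iff_edges S list_all_iff
    by (fastforce split: if_splits)
qed

lemma inflatable_if_check:
  assumes "inflatable_check W A B A' B'"
  shows "inflatable W (adj A) (adj B) (adj A') (adj B')"
    and "\<And>w a. w \<in> set W \<Longrightarrow> a \<in> set w \<Longrightarrow> a < length A"
  using assms unfolding inflatable_check_def inflatable_def adj_iff_edges list_all_iff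
  by fastforce+

definition level_set :: "nat \<Rightarrow> (int \<Rightarrow> int \<Rightarrow> nat) set" where
  "level_set i = tilings (adj (level_h i)) (adj (level_v i))"

lemma level_set_eq:
  assumes "5 \<le> i" "i \<le> 14"
  shows "level_set i = tilings (h_adj (level_tiles i)) (v_adj (level_tiles i))"
proof -
  have "level_set i = tilings (h_adj (level_tiles i)) (v_adj (level_tiles i))" if "refined i" for i
  proof
    show "level_set i \<subseteq> tilings (h_adj (level_tiles i)) (v_adj (level_tiles i))"
      using refined_adjD[OF that] unfolding level_set_def by (blast intro: tilings_mono)
    show "tilings (h_adj (level_tiles i)) (v_adj (level_tiles i)) \<subseteq> level_set i"
      using that unfolding level_set_def refined_def by (blast intro: tilings_refined)
  qed
  note eq = this
  show ?thesis
  proof (cases "i = 14")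
    case True
    have "h_adj (level_tiles 14) = h_adj (level_tiles 12)" "v_adj (level_tiles 14) = v_adj (level_tiles 12)"
      using level_14 by (metis entry_colour_matrix(1), metis entry_colour_matrix(2))
    moreover have "level_set 14 = level_set 12"
      by (simp add: level_set_def level_h_def level_v_def)
    moreover have "refined 12"
      using all_refined by (simp add: list_all_iff)
    ultimately show ?thesis
      using eq True by simp
  next
    case False
    with assms have "refined i"
      using all_refined unfolding list_all_iff set_upt by simp
    then show ?thesis by (rule eq)
  qed
qed

lemma level_set_14: "level_set 14 = level_set 12"
  by (simp add: level_set_def level_h_def level_v_def)

lemma level_tiles_Suc:
  assumes "6 \<le> i" "i \<le> 13"
  shows "level_tiles (Suc i) =
    map (image_tile (level_direction i) (level_tiles i)) (level_images i)"
proof -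
  consider "i \<le> 11" | "i = 12" | "i = 13"
    using assms by linarith
  then show ?thesis
    using assms by cases (auto simp: level_tiles_def level_direction_def level_images_def rule_direction_def)
qed

text \<open>Concatenating equal colors gives equal colors. In general only this direction holds,
  since equal concatenations may split differently; for the surviving adjacencies
  \<open>inflatable_check\<close> supplies the other one.\<close>

lemma
  fixes ts rs d
  defines "ts' \<equiv> map (image_tile d ts) rs" and "W \<equiv> map word rs"
  shows lift_horizontal: "d = Horizontal \<Longrightarrow> lift_h W (h_adj ts) a b \<Longrightarrow> h_adj ts' a b"
      "d = Horizontal \<Longrightarrow> lift_v W (v_adj ts) a b \<Longrightarrow> v_adj ts' a b"
    and lift_vertical: "d = Vertical \<Longrightarrow> lift_h W (v_adj ts) a b \<Longrightarrow> v_adj ts' a b"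
      "d = Vertical \<Longrightarrow> lift_v W (h_adj ts) a b \<Longrightarrow> h_adj ts' a b"
proof -
  have image: "ts' ! c = image_tile d ts (rs ! c)" "W ! c = word (rs ! c)" if "c < length W" for c
    using that by (simp_all add: ts'_def W_def)
  have len: "length ts' = length W"
    by (simp add: ts'_def W_def)
  show "d = Horizontal \<Longrightarrow> lift_h W (h_adj ts) a b \<Longrightarrow> h_adj ts' a b"
    by (cases "rs ! a"; cases "rs ! b") (auto simp: lift_h_def h_adj_def image len)
  show "d = Vertical \<Longrightarrow> lift_h W (v_adj ts) a b \<Longrightarrow> v_adj ts' a b"
    by (cases "rs ! a"; cases "rs ! b") (auto simp: lift_h_def v_adj_def image len)
  show "d = Horizontal \<Longrightarrow> lift_v W (v_adj ts) a b \<Longrightarrow> v_adj ts' a b"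
    by (cases "rs ! a"; cases "rs ! b") (auto simp: lift_v_def v_adj_def image len)
  show "d = Vertical \<Longrightarrow> lift_v W (h_adj ts) a b \<Longrightarrow> h_adj ts' a b"
    by (cases "rs ! a"; cases "rs ! b") (auto simp: lift_v_def h_adj_def image len)
qed

definition orient :: "nat \<Rightarrow> (int \<Rightarrow> int \<Rightarrow> nat) set \<Rightarrow> (int \<Rightarrow> int \<Rightarrow> nat) set" where
  "orient i X = (if level_direction i = Horizontal then X else flip ` X)"

lemma level_checkD:
  assumes "6 \<le> i" "i \<le> 13"
  shows "level_check i"
  using assms all_level_check unfolding list_all_iff set_upt by simp

lemma lift_mono:
  "lift_h W h a b \<Longrightarrow> (\<And>a b. h a b \<Longrightarrow> h' a b) \<Longrightarrow> lift_h W h' a b"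
  "lift_v W v a b \<Longrightarrow> (\<And>a b. v a b \<Longrightarrow> v' a b) \<Longrightarrow> lift_v W v' a b"
  by (auto simp: lift_h_def lift_v_def elim: list_all2_mono)

lemma desub_if_fusing:
  assumes "fusing W h v" and "\<And>a b. lift_h W h a b \<Longrightarrow> h' a b" and "\<And>a b. lift_v W v a b \<Longrightarrow> v' a b"
  shows "desub W (tilings h v) (tilings h' v')"
  unfolding desub_def
proof
  fix x assume "x \<in> tilings h v"
  from ex_desubstitution[OF this assms(1)] obtain y p
    where "y \<in> tilings (lift_h W h) (lift_v W v)" "inflates W p y x" by blast
  with assms(2,3) show "\<exists>y\<in>tilings h' v'. \<exists>p. inflates W p y x"
    by (blast intro: tilings_mono)
qed

lemma orient_empty_iff: "orient i X = {} \<longleftrightarrow> X = {}"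
  by (simp add: orient_def)

text \<open>A desubstituted tiling at first only respects the colors of the fused tiles. As pruning
  loses no tilings, it then satisfies the smaller relations in the tables of the next level as
  well.\<close>

lemma level_step:
  assumes i: "6 \<le> i" "i \<le> 13"
  obtains h v h' v' l where
    "orient i (level_set i) = tilings h v"
    "orient i (level_set (Suc i)) = tilings h' v'"
    "fusing (level_words i) h v"
    "inflatable (level_words i) h v h' v'"
    "\<And>w a. w \<in> set (level_words i) \<Longrightarrow> a \<in> set w \<Longrightarrow> a < l"
    "\<And>a b. h' a b \<Longrightarrow> a < length (level_words i)"
    "desub (level_words i) (tilings h v) (tilings h' v')"
proof -
  let ?W = "level_words i" and ?A = "level_h i" and ?B = "level_v i"
  let ?A' = "level_h (Suc i)" and ?B' = "level_v (Suc i)"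
  let ?t = "level_tiles (Suc i)"
  note check = level_checkD[OF i, unfolded level_check_def Let_def]
  from i have "refined i"
    using all_refined unfolding list_all_iff set_upt by simp
  note adjD = refined_adjD[OF this]
  have set_Suc: "tilings (adj ?A') (adj ?B') = tilings (h_adj ?t) (v_adj ?t)"
    using i level_set_eq[of "Suc i"] by (simp add: level_set_def)
  then have set_Suc': "tilings (adj ?B') (adj ?A') = tilings (v_adj ?t) (h_adj ?t)"
    by (metis flip_tilings)
  have less: "a < length ?W" if "adj ?A' a b \<or> adj ?B' a b" for a b
    using check that by (auto simp: adj_def)
  show ?thesis
  proof (cases "level_direction i")
    case Horizontal
    then have fus: "fusing ?W (adj ?A) (adj ?B)"
      and "inflatable_check ?W ?A ?B ?A' ?B'"
      using check by (simp_all add: fusing_if_check)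
    note inf = inflatable_if_check[OF this(2)]
    have "desub ?W (tilings (adj ?A) (adj ?B)) (tilings (adj ?A') (adj ?B'))"
      unfolding set_Suc
    proof (rule desub_if_fusing[OF fus])
      show "h_adj ?t a b" if "lift_h ?W (adj ?A) a b" for a b
      proof -
        from that have "lift_h ?W (h_adj (level_tiles i)) a b"
          by (rule lift_mono(1)) (rule adjD(1))
        then show ?thesis
          unfolding level_tiles_Suc[OF i] level_words_def by (rule lift_horizontal(1)[OF Horizontal])
      qed
      show "v_adj ?t a b" if "lift_v ?W (adj ?B) a b" for a b
      proof -
        from that have "lift_v ?W (v_adj (level_tiles i)) a b"
          by (rule lift_mono(2)) (rule adjD(2))
        then show ?thesis
          unfolding level_tiles_Suc[OF i] level_words_def by (rule lift_horizontal(2)[OF Horizontal])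
      qed
    qed
    then show ?thesis
      by (intro that[where l = "length ?A", OF _ _ fus inf(1)])
        (use Horizontal less inf(2) in \<open>auto simp: orient_def level_set_def\<close>)
  next
    case Vertical
    then have fus: "fusing ?W (adj ?B) (adj ?A)"
      and "inflatable_check ?W ?B ?A ?B' ?A'"
      using check by (simp_all add: fusing_if_check)
    note inf = inflatable_if_check[OF this(2)]
    have "desub ?W (tilings (adj ?B) (adj ?A)) (tilings (adj ?B') (adj ?A'))"
      unfolding set_Suc'
    proof (rule desub_if_fusing[OF fus])
      show "v_adj ?t a b" if "lift_h ?W (adj ?B) a b" for a b
      proof -
        from that have "lift_h ?W (v_adj (level_tiles i)) a b"
          by (rule lift_mono(1)) (rule adjD(2))
        then show ?thesis
          unfolding level_tiles_Suc[OF i] level_words_def by (rule lift_vertical(1)[OF Vertical])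
      qed
      show "h_adj ?t a b" if "lift_v ?W (adj ?A) a b" for a b
      proof -
        from that have "lift_v ?W (h_adj (level_tiles i)) a b"
          by (rule lift_mono(2)) (rule adjD(1))
        then show ?thesis
          unfolding level_tiles_Suc[OF i] level_words_def by (rule lift_vertical(2)[OF Vertical])
      qed
    qed
    then show ?thesis
      by (intro that[where l = "length ?B", OF _ _ fus inf(1)])
        (use Vertical less inf(2) in \<open>auto simp: orient_def level_set_def\<close>)
  qed
qed

lemma level_desub:
  assumes "6 \<le> i" "i \<le> 13"
  shows "desub (level_words i) (orient i (level_set i)) (orient i (level_set (Suc i)))"
  by (rule level_step[OF assms]) simp

lemma level_words_fusing:
  assumes "6 \<le> i" "i \<le> 13"
  shows "distinct (level_words i)"
    and "w \<in> set (level_words i) \<Longrightarrow> hd w \<notin> seconds (level_words i)"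
  by (rule level_step[OF assms], simp add: fusing_def)+

lemma level_set_nonempty:
  assumes "6 \<le> i" "i \<le> 13" and "level_set (Suc i) \<noteq> {}"
  shows "level_set i \<noteq> {}"
proof -
  obtain h v h' v' l where step:
    "orient i (level_set i) = tilings h v"
    "orient i (level_set (Suc i)) = tilings h' v'"
    "inflatable (level_words i) h v h' v'"
    "\<And>a b. h' a b \<Longrightarrow> a < length (level_words i)"
    "\<And>w a. w \<in> set (level_words i) \<Longrightarrow> a \<in> set w \<Longrightarrow> a < l"
    by (rule level_step[OF assms(1,2)]) blast
  have "tilings h' v' \<noteq> {}"
    using assms(3) orient_empty_iff step(2) by metis
  then have "tilings h v \<noteq> {}"
    by (rule tilings_nonempty_inflate[OF _ step(3)]) (use step(4,5) in blast)+
  then show ?thesis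
    using orient_empty_iff step(1) by metis
qed

lemma level_no_periods:
  assumes "6 \<le> i" "i \<le> 13" and "no_periods (level_set (Suc i))"
  shows "no_periods (level_set i)"
proof -
  have "no_periods X" if "desub (level_words i) X Y" "no_periods Y" for X Y
    unfolding no_periods_def
  proof (intro ballI allI impI)
    fix x a b assume x: "x \<in> X" and per: "period x a b"
    from that(1) x obtain y p where y: "y \<in> Y" "inflates (level_words i) p y x"
      by (auto simp: desub_def)
    obtain a' where "period y a' b" "a' = 0 \<longleftrightarrow> a = 0"
      by (rule period_desubstitution[OF y(2) per level_words_fusing[OF assms(1,2)]])
    with that(2) y(1) show "a = 0 \<and> b = 0"
      unfolding no_periods_def by blast
  qed
  from this[OF level_desub[OF assms(1,2)]] assms(3) show ?thesis
    by (cases "level_direction i = Horizontal") (auto simp: orient_def no_periods_flip)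
qed

lemma level_recurs:
  assumes "6 \<le> i" "i \<le> 13" and "\<And>n m. recurs n m (level_set (Suc i))"
  shows "recurs n m (level_set i)"
proof (cases "level_direction i = Horizontal")
  case True
  with recurs_desub[OF level_desub[OF assms(1,2)], of n m] assms(3) show ?thesis
    by (simp add: orient_def)
next
  case False
  with recurs_desub[OF level_desub[OF assms(1,2)], of m n] assms(3) show ?thesis
    by (simp add: orient_def recurs_flip)
qed

section \<open>Self-similarity of level 12\<close>

definition expanding_check :: "nat list list \<Rightarrow> nat list list \<Rightarrow> bool" where
  "expanding_check W A \<longleftrightarrow>
     list_all (\<lambda>(a, b). length (W ! a) \<noteq> 1 \<or> length (W ! b) \<noteq> 1) (edges A)"

definition single_check :: "nat list list \<Rightarrow> nat list list \<Rightarrow> bool" where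
  "single_check W V \<longleftrightarrow>
     list_all (\<lambda>w. length w = 1 \<longrightarrow> list_all (\<lambda>u. length (W ! u) \<noteq> 1) (V ! hd w)) W"

text \<open>The arguments are crossed because words of level 13 are indexed by letters of level 14,
  that is, of level 12, and words of level 12 by letters of level 13.\<close>

lemma checks_12_13:
  "expanding_check (level_words 13) (level_h 12)" "expanding_check (level_words 12) (level_v 13)"
  "single_check (level_words 13) (level_words 12)" "single_check (level_words 12) (level_words 13)"
  by code_simp+

lemma expanding_if_check: "expanding_check W A \<Longrightarrow> expanding W (adj A)"
  by (auto simp: expanding_check_def expanding_def adj_iff_edges list_all_iff)

lemma single_if_check:
  assumes "single_check W V" "s < length W" "length (W ! s) = 1" "u \<in> set (V ! (W ! s ! 0))"
  shows "length (W ! u) \<noteq> 1"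
proof -
  have "W ! s \<in> set W" "hd (W ! s) = W ! s ! 0"
    using assms(2,3) by (auto intro: hd_conv_nth)
  with assms show ?thesis
    by (auto simp: single_check_def list_all_iff)
qed

lemma desub_13: "desub (level_words 13) (level_set 13) (level_set 12)"
  using level_desub[of 13] by (simp add: orient_def level_set_14 level_direction_def rule_direction_def)

lemma desub_12: "desub (level_words 12) (flip ` level_set 12) (flip ` level_set 13)"
  using level_desub[of 12] by (simp add: orient_def level_direction_def)

lemma no_periods_12: "no_periods (level_set 12)"
  unfolding no_periods_def
proof (intro ballI allI impI)
  have "a = 0 \<and> b = 0" if "x \<in> level_set 12" "period x a b" for x a b
    using that
  \<comment> \<open>One turn of the cycle shortens \<open>b\<close> through the vertical fusion and
    \<open>a\<close> through the horizontal one, each unless it is zero.\<close>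
  proof (induction "nat (\<bar>a\<bar> + \<bar>b\<bar>)" arbitrary: x a b rule: less_induct)
    case less
    from desub_12 less.prems(1) obtain y p
      where y: "y \<in> level_set 13" "inflates (level_words 12) p (flip y) (flip x)"
      by (auto simp: desub_def)
    have "flip y \<in> tilings (adj (level_v 13)) (adj (level_h 13))"
      using y(1) by (simp add: level_set_def)
    then have ex: "\<exists>k j. length (level_words 12 ! flip y k j) \<noteq> 1"
      using expanding_if_check[OF checks_12_13(2)] tilingsD(1) unfolding expanding_def by blast
    have "period (flip x) b a"
      using less.prems(2) by simp
    from y(2) this obtain b' where b': "period (flip y) b' a" "b' = 0 \<longleftrightarrow> b = 0" "\<bar>b'\<bar> \<le> \<bar>b\<bar>"
      "b \<noteq> 0 \<Longrightarrow> \<bar>b'\<bar> < \<bar>b\<bar>"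
      by (rule period_desubstitution) (use level_words_fusing[of 12] ex in auto)
    from desub_13 y(1) obtain z q
      where z: "z \<in> level_set 12" "inflates (level_words 13) q z y"
      by (auto simp: desub_def)
    have "z \<in> tilings (adj (level_h 12)) (adj (level_v 12))"
      using z(1) by (simp add: level_set_def)
    then have ex': "\<exists>k j. length (level_words 13 ! z k j) \<noteq> 1"
      using expanding_if_check[OF checks_12_13(1)] tilingsD(1) unfolding expanding_def by blast
    have "period y a b'"
      using b'(1) by simp
    from z(2) this obtain a' where a': "period z a' b'" "a' = 0 \<longleftrightarrow> a = 0" "\<bar>a'\<bar> \<le> \<bar>a\<bar>"
      "a \<noteq> 0 \<Longrightarrow> \<bar>a'\<bar> < \<bar>a\<bar>"
      by (rule period_desubstitution) (use level_words_fusing[of 13] ex' in auto)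
    show ?case
    proof (rule ccontr)
      assume "\<not> (a = 0 \<and> b = 0)"
      then have "\<bar>a'\<bar> + \<bar>b'\<bar> < \<bar>a\<bar> + \<bar>b\<bar>"
        using a'(3,4) b'(3,4) by linarith
      then have "nat (\<bar>a'\<bar> + \<bar>b'\<bar>) < nat (\<bar>a\<bar> + \<bar>b\<bar>)"
        by linarith
      from less.hyps[OF this z(1) a'(1)] a'(2) b'(2) \<open>\<not> (a = 0 \<and> b = 0)\<close> show False
        by simp
    qed
  qed
  then show "a = 0 \<and> b = 0" if "x \<in> level_set 12" "period x a b" for x a b
    using that .
qed

text \<open>One of the first two letters of the bottom row has a longer word, and all rows grow by
  the same amount.\<close>

lemma patch_grow:
  assumes y: "patch (length W) h' v' n m y" and W: "inflatable W h v h' v'" "expanding W h'"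
    and l: "\<And>w a. w \<in> set W \<Longrightarrow> a \<in> set w \<Longrightarrow> a < l" and "2 \<le> n" "0 < m"
  shows "\<exists>x. patch l h v (Suc n) m x"
proof -
  have ne: "\<forall>k < n. \<forall>j < m. W ! y k j \<noteq> []"
    using y W(1) by (auto simp: patch_def inflatable_def)
  obtain n' x where x: "patch l h v n' m x" "n \<le> n'"
    "\<forall>k < n. length (W ! y k 0) \<noteq> 1 \<longrightarrow> n < n'"
    by (rule patch_inflate[OF y W(1) l ne \<open>0 < m\<close>])
  have "h' (y 0 0) (y 1 0)"
    using y \<open>2 \<le> n\<close> \<open>0 < m\<close> by (auto simp: patch_def)
  then have "n < n'"
    using W(2) x(3)[rule_format, of 0] x(3)[rule_format, of 1] \<open>2 \<le> n\<close>
    unfolding expanding_def by auto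
  then show ?thesis
    using patch_mono[OF x(1), of "Suc n" m] by auto
qed

lemma level_lengths:
  "length (level_h 13) = 21" "length (level_v 12) = 19"
  "length (level_words 13) = 19" "length (level_words 12) = 21"
  by code_simp+

lemma inflatable_13:
  "inflatable (level_words 13) (adj (level_h 13)) (adj (level_v 13)) (adj (level_h 12)) (adj (level_v 12))"
  "w \<in> set (level_words 13) \<Longrightarrow> a \<in> set w \<Longrightarrow> a < 21"
proof -
  have "level_direction 13 = Horizontal" "level_h 14 = level_h 12" "level_v 14 = level_v 12"
    by (simp_all add: level_direction_def rule_direction_def level_h_def level_v_def)
  then have "inflatable_check (level_words 13) (level_h 13) (level_v 13) (level_h 12) (level_v 12)"
    using level_checkD[of 13] by (simp add: level_check_def Let_def)
  from inflatable_if_check[OF this]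
  show "inflatable (level_words 13) (adj (level_h 13)) (adj (level_v 13)) (adj (level_h 12)) (adj (level_v 12))"
    and "w \<in> set (level_words 13) \<Longrightarrow> a \<in> set w \<Longrightarrow> a < 21"
    by (simp_all add: level_lengths)
qed

lemma inflatable_12:
  "inflatable (level_words 12) (adj (level_v 12)) (adj (level_h 12)) (adj (level_v 13)) (adj (level_h 13))"
  "w \<in> set (level_words 12) \<Longrightarrow> a \<in> set w \<Longrightarrow> a < 19"
proof -
  have "level_direction 12 = Vertical"
    by (simp add: level_direction_def)
  then have "inflatable_check (level_words 12) (level_v 12) (level_h 12) (level_v 13) (level_h 13)"
    using level_checkD[of 12] by (simp add: level_check_def Let_def)
  from inflatable_if_check[OF this]
  show "inflatable (level_words 12) (adj (level_v 12)) (adj (level_h 12)) (adj (level_v 13)) (adj (level_h 13))"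
    and "w \<in> set (level_words 12) \<Longrightarrow> a \<in> set w \<Longrightarrow> a < 19"
    by (simp_all add: level_lengths)
qed

lemma level_set_12_nonempty: "level_set 12 \<noteq> {}"
  unfolding level_set_def
proof (rule tiling_of_patches)
  fix n
  \<comment> \<open>Growth requires side at least 2, hence the offset. The seed below is the square
    \<open>(16, 3, 10, 1)\<close>, which is also where the search for squares starts.\<close>
  have "\<exists>x. patch 19 (adj (level_h 12)) (adj (level_v 12)) (n + 2) (n + 2) x"
  proof (induction n)
    case 0
    have "adj (level_h 12) 16 3 \<and> adj (level_h 12) 10 1 \<and>
        adj (level_v 12) 16 10 \<and> adj (level_v 12) 3 1"
      by code_simp
    then show ?case
      by (intro exI[of _ "\<lambda>i j. if j = 0 then if i = 0 then 16 else 3 else if i = 0 then 10 else 1"])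
        (auto simp: patch_def)
  next
    case (Suc n)
    then obtain x where x: "patch (length (level_words 13)) (adj (level_h 12)) (adj (level_v 12)) (n + 2) (n + 2) x"
      using level_lengths(3) by auto
    have "\<exists>y. patch 21 (adj (level_h 13)) (adj (level_v 13)) (Suc (n + 2)) (n + 2) y"
      by (rule patch_grow[OF x inflatable_13(1) expanding_if_check[OF checks_12_13(1)]])
        (auto intro: inflatable_13(2))
    then obtain y where "patch 21 (adj (level_h 13)) (adj (level_v 13)) (Suc (n + 2)) (n + 2) y" ..
    then have "patch (length (level_words 12)) (adj (level_v 13)) (adj (level_h 13)) (n + 2) (Suc (n + 2)) (flip y)"
      by (simp add: patch_flip level_lengths(4))
    then have "\<exists>z. patch 19 (adj (level_v 12)) (adj (level_h 12)) (Suc (n + 2)) (Suc (n + 2)) z"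
      by (rule patch_grow[OF _ inflatable_12(1) expanding_if_check[OF checks_12_13(2)]])
        (auto intro: inflatable_12(2))
    then obtain z where "patch 19 (adj (level_v 12)) (adj (level_h 12)) (Suc (n + 2)) (Suc (n + 2)) z" ..
    then have "patch 19 (adj (level_h 12)) (adj (level_v 12)) (Suc (n + 2)) (Suc (n + 2)) (flip z)"
      by (simp add: patch_flip)
    then show ?case by auto
  qed
  then show "\<exists>x. patch 19 (adj (level_h 12)) (adj (level_v 12)) n n x"
    by (meson le_add1 patch_mono)
qed

section \<open>Recurrence of the squares of side 2\<close>

definition occurs_in_all :: "square \<Rightarrow> (int \<Rightarrow> int \<Rightarrow> nat) set \<Rightarrow> bool" where
  "occurs_in_all q X \<longleftrightarrow> (\<forall>x\<in>X. \<exists>i j. square_at x i j = q)"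

lemma occurs_in_all_flip: "occurs_in_all (flip_square q) (flip ` X) \<longleftrightarrow> occurs_in_all q X"
proof -
  have "(\<exists>i j. square_at (flip x) i j = flip_square q) \<longleftrightarrow> (\<exists>i j. square_at x i j = q)" for x
    by (metis flip_square_flip square_at_flip)
  then show ?thesis by (simp add: occurs_in_all_def)
qed

lemma occurs_in_all_inflate:
  assumes "desub W X Y" and "occurs_in_all q Y" and "q' \<in> set (inflate_square W q)"
  shows "occurs_in_all q' X"
  unfolding occurs_in_all_def
proof
  fix x assume "x \<in> X"
  with assms(1) obtain y p where y: "y \<in> Y" "inflates W p y x" by (auto simp: desub_def)
  with assms(2) obtain k j where "square_at y k j = q" by (auto simp: occurs_in_all_def)
  with assms(3) inflate_square_iff[OF y(2), of q' k j] show "\<exists>i j. square_at x i j = q'" by auto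
qed

definition inflate_square_vertically :: "nat list list \<Rightarrow> square \<Rightarrow> square list" where
  "inflate_square_vertically W q = map flip_square (inflate_square W (flip_square q))"

definition successors :: "nat list list \<Rightarrow> nat list list \<Rightarrow> square \<Rightarrow> square list" where
  "successors V W q = concat (map (inflate_square_vertically V) (inflate_square W q))"

lemma occurs_in_all_successors:
  assumes "occurs_in_all q (level_set 12)" and "q' \<in> set (successors (level_words 12) (level_words 13) q)"
  shows "occurs_in_all q' (level_set 12)"
proof -
  from assms(2) obtain r where r: "r \<in> set (inflate_square (level_words 13) q)"
    "q' \<in> set (inflate_square_vertically (level_words 12) r)"
    by (auto simp: successors_def)
  have "occurs_in_all r (level_set 13)"
    by (rule occurs_in_all_inflate[OF desub_13 assms(1) r(1)])
  then have "occurs_in_all (flip_square r) (flip ` level_set 13)"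
    by (simp add: occurs_in_all_flip)
  from occurs_in_all_inflate[OF desub_12 this, of "flip_square q'"] r(2) show ?thesis
    by (auto simp: inflate_square_vertically_def occurs_in_all_flip)
qed

fun visit :: "bool \<Rightarrow> square \<Rightarrow> square list \<times> square list \<Rightarrow> square list \<times> square list" where
  "visit True q (todo, seen) = (todo, seen)"
| "visit False q (todo, seen) = (q # todo, q # seen)"

fun visit_all :: "square list \<Rightarrow> square list \<times> square list \<Rightarrow> square list \<times> square list" where
  "visit_all [] st = st"
| "visit_all (q # qs) (todo, seen) = visit_all qs (visit (List.member seen q) q (todo, seen))"

text \<open>A worklist search with fuel \<open>n\<close>. Running out of fuel only leaves squares
  out, so everything found has the invariant for any \<open>n\<close>.\<close>

fun explore ::
    "nat list list \<Rightarrow> nat list list \<Rightarrow> nat \<Rightarrow> square list \<times> square list \<Rightarrow> square list" where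
  "explore V W 0 (todo, seen) = seen"
| "explore V W (Suc n) ([], seen) = seen"
| "explore V W (Suc n) (q # todo, seen) =
     explore V W n (visit_all (successors V W q) (todo, seen))"

definition all_seen :: "(square \<Rightarrow> bool) \<Rightarrow> square list \<times> square list \<Rightarrow> bool" where
  "all_seen P st \<longleftrightarrow> list_all P (fst st) \<and> list_all P (snd st)"

lemma all_seen_visit_all: "list_all P qs \<Longrightarrow> all_seen P st \<Longrightarrow> all_seen P (visit_all qs st)"
proof (induction qs st rule: visit_all.induct)
  case (2 q qs todo seen)
  then show ?case by (cases "List.member seen q") (auto simp: all_seen_def)
qed simp

lemma explore_invariant:
  assumes "\<And>q q'. P q \<Longrightarrow> q' \<in> set (successors V W q) \<Longrightarrow> P q'"
  shows "all_seen P st \<Longrightarrow> list_all P (explore V W n st)"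
  using assms
proof (induction V W n st rule: explore.induct)
  case (3 V W n q todo seen)
  from "3.prems"(1) have "P q"
    by (simp add: all_seen_def)
  with "3.prems"(2) have "list_all P (successors V W q)"
    unfolding list_all_iff by blast
  moreover have "all_seen P (todo, seen)"
    using "3.prems"(1) by (simp add: all_seen_def)
  ultimately have "all_seen P (visit_all (successors V W q) (todo, seen))"
    by (rule all_seen_visit_all)
  from "3.IH"[OF this "3.prems"(2)] show ?case by simp
qed (auto simp: all_seen_def)

fun combine_edges :: "nat \<times> nat \<Rightarrow> nat \<times> nat \<Rightarrow> square" where
  "combine_edges (a, b) (c, d) = (a, b, c, d)"

fun fits_below :: "bool list list \<Rightarrow> nat \<times> nat \<Rightarrow> nat \<times> nat \<Rightarrow> bool" where
  "fits_below M (a, b) (c, d) \<longleftrightarrow> entry M a c \<and> entry M b d"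

fun squares_above :: "bool list list \<Rightarrow> (nat \<times> nat) list \<Rightarrow> nat \<times> nat \<Rightarrow> square list" where
  "squares_above M es (a, b) = map (combine_edges (a, b)) (filter (fits_below M (a, b)) es)"

definition squares_over :: "bool list list \<Rightarrow> (nat \<times> nat) list \<Rightarrow> square list" where
  "squares_over M es = concat (map (squares_above M es) es)"

definition covers :: "nat list list \<Rightarrow> square list \<Rightarrow> square list \<Rightarrow> bool" where
  "covers V rs qs \<longleftrightarrow>
     list_all (List.member qs) (concat (map (inflate_square_vertically V) rs))"

text \<open>Each square in a tiling of level 12 lies in the vertical inflation of a square of level
  13. So it suffices to inflate all squares of level 13 that the tables permit; 60 steps of the
  search find all the results.\<close>

lemma covers_squares:
  "covers (level_words 12) (squares_over (matrix (level_v 13)) (edges (level_h 13)))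
     (explore (level_words 12) (level_words 13) 60 ([(16, 3, 10, 1)], [(16, 3, 10, 1)]))"
  by code_simp

definition predecessors :: "nat list list \<Rightarrow> nat list \<Rightarrow> nat list" where
  "predecessors W S = filter (\<lambda>t. list_ex (List.member S) (W ! t)) [0..<length W]"

definition hits :: "nat list \<Rightarrow> (int \<Rightarrow> int \<Rightarrow> nat) set \<Rightarrow> bool" where
  "hits S X \<longleftrightarrow> (\<forall>x\<in>X. \<exists>i j. x i j \<in> set S)"

lemma hits_flip: "hits S (flip ` X) \<longleftrightarrow> hits S X"
  by (simp add: hits_def) metis

text \<open>A letter whose word meets \<open>S\<close> puts a letter of \<open>S\<close> into the
  inflated tiling, so an unavoidable set of letters one level up gives an unavoidable set
  here.\<close>

lemma hits_predecessors:
  assumes "desub W X Y" and "hits (predecessors W S) Y"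
  shows "hits S X"
  unfolding hits_def
proof
  fix x assume "x \<in> X"
  with assms(1) obtain y p where y: "y \<in> Y" "inflates W p y x" by (auto simp: desub_def)
  with assms(2) obtain k j where "y k j \<in> set (predecessors W S)" by (auto simp: hits_def)
  then obtain s where "s \<in> set (W ! y k j)" "s \<in> set S"
    by (auto simp: predecessors_def list_ex_iff)
  then obtain r where "r < length (W ! y k j)" "W ! y k j ! r \<in> set S"
    by (metis in_set_conv_nth)
  with y(2) show "\<exists>i j. x i j \<in> set S"
    by (metis inflates_def)
qed

definition predecessors_twice :: "nat list \<Rightarrow> nat list" where
  "predecessors_twice S = predecessors (level_words 13) (predecessors (level_words 12) S)"

lemma hits_predecessors_twice:
  assumes "hits (predecessors_twice S) (level_set 12)"
  shows "hits S (level_set 12)"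
proof -
  have "hits (predecessors (level_words 12) S) (level_set 13)"
    using assms unfolding predecessors_twice_def by (rule hits_predecessors[OF desub_13])
  then have "hits S (flip ` level_set 12)"
    by (intro hits_predecessors[OF desub_12]) (simp add: hits_flip)
  then show ?thesis by (simp add: hits_flip)
qed

text \<open>A form of primitivity: after four turns of the cycle the inflation of every tile
  contains tile 14.\<close>

lemma predecessors_14:
  "predecessors_twice (predecessors_twice (predecessors_twice (predecessors_twice [14]))) = [0..<19]"
  by code_simp

lemma hits_14: "hits [14] (level_set 12)"
proof -
  have "length (level_h 12) = 19"
    by code_simp
  then have "x i j < 19" if "x \<in> level_set 12" for x i j
    using tilingsD(1)[OF that[unfolded level_set_def], of i j] by (simp add: adj_def)
  then have "hits [0..<19] (level_set 12)"
    by (simp add: hits_def)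
  from this[folded predecessors_14] show ?thesis
    by (blast dest: hits_predecessors_twice)
qed

text \<open>
  Tile 14 is inflated to a full \<open>2 \<times> 2\<close> square, from which all others are then reached.
\<close>

lemma words_of_14:
  "level_words 13 ! 14 = [18, 9]" "level_words 12 ! 18 = [16, 10]" "level_words 12 ! 9 = [3, 1]"
  by code_simp+

lemma initial_square: "occurs_in_all (16, 3, 10, 1) (level_set 12)"
  unfolding occurs_in_all_def
proof
  fix z assume "z \<in> level_set 12"
  with desub_12 obtain y q where y: "y \<in> level_set 13" "inflates (level_words 12) q (flip y) (flip z)"
    by (auto simp: desub_def)
  with desub_13 obtain x p where x: "x \<in> level_set 12" "inflates (level_words 13) p x y"
    by (auto simp: desub_def)
  from hits_14 x(1) obtain k l where kl: "x k l = 14"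
    by (auto simp: hits_def)
  have two: "f (r i) j = a" "f (r i + 1) j = b"
    if "inflates W r g f" "W ! g i j = [a, b]" for W r g f i j a b
  proof -
    have "\<forall>n < length (W ! g i j). f (r i + int n) j = W ! g i j ! n"
      using that(1) by (simp add: inflates_def)
    from this[rule_format, of 0] this[rule_format, of 1] that(2)
    show "f (r i) j = a" "f (r i + 1) j = b" by simp_all
  qed
  have "y (p k) l = 18" "y (p k + 1) l = 9"
    using two[OF x(2), of k l] kl words_of_14 by simp_all
  then have "square_at z (p k) (q l) = (16, 3, 10, 1)"
    using two[OF y(2), of l "p k"] two[OF y(2), of l "p k + 1"] words_of_14
    by (simp add: square_at_def)
  then show "\<exists>i j. square_at z i j = (16, 3, 10, 1)" by blast
qed

lemma recurs_two_12: "recurs 2 2 (level_set 12)"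
  unfolding recurs_def
proof (intro ballI allI)
  fix x z a b assume x: "x \<in> level_set 12" and z: "z \<in> level_set 12"
  from desub_12 x obtain y p where y: "y \<in> level_set 13" "inflates (level_words 12) p (flip y) (flip x)"
    by (auto simp: desub_def)
  obtain k where "square_at (flip x) b a \<in> set (inflate_square (level_words 12) (square_at (flip y) k a))"
    by (rule ex_inflate_square[OF y(2)])
  then have inflated: "square_at x a b \<in> set (inflate_square_vertically (level_words 12) (square_at y a k))"
    unfolding inflate_square_vertically_def square_at_flip
    by (metis flip_square_flip image_eqI list.set_map)
  have entry: "entry (matrix (level_v 13)) c d" if "adj (level_v 13) c d" for c d
  proof -
    have "bounded (level_v 13)"
      using all_refined by (simp add: list_all_iff refined_def)
    with that show ?thesis
      by (auto simp: bounded_def entry_matrix adj_def list_all_iff)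
  qed
  let ?e = "(y a k, y (a + 1) k)"
  note y_adj = tilingsD[OF y(1)[unfolded level_set_def]]
  have "square_at y a k \<in> set (squares_above (matrix (level_v 13)) (edges (level_h 13)) ?e)"
    using y_adj(1)[of a "k + 1"] entry[OF y_adj(2)[of a k]] entry[OF y_adj(2)[of "a + 1" k]]
    by (auto simp: square_at_def adj_iff_edges intro!: image_eqI)
  then have "square_at y a k \<in> set (squares_over (matrix (level_v 13)) (edges (level_h 13)))"
    using y_adj(1)[of a k] unfolding squares_over_def adj_iff_edges by (auto simp del: squares_above.simps)
  with inflated have "square_at x a b \<in> set (concat (map (inflate_square_vertically (level_words 12))
      (squares_over (matrix (level_v 13)) (edges (level_h 13)))))"
    unfolding set_concat set_map by blast
  then have "List.member (explore (level_words 12) (level_words 13) 60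
      ([(16, 3, 10, 1)], [(16, 3, 10, 1)])) (square_at x a b)"
    using covers_squares unfolding covers_def list_all_iff by blast
  then have "square_at x a b \<in>
      set (explore (level_words 12) (level_words 13) 60 ([(16, 3, 10, 1)], [(16, 3, 10, 1)]))"
    by simp
  moreover have "list_all (\<lambda>q. occurs_in_all q (level_set 12))
      (explore (level_words 12) (level_words 13) 60 ([(16, 3, 10, 1)], [(16, 3, 10, 1)]))"
  proof (rule explore_invariant)
    show "all_seen (\<lambda>q. occurs_in_all q (level_set 12)) ([(16, 3, 10, 1)], [(16, 3, 10, 1)])"
      using initial_square by (simp add: all_seen_def)
  qed (rule occurs_in_all_successors)
  ultimately have "occurs_in_all (square_at x a b) (level_set 12)"
    unfolding list_all_iff by blast
  with z obtain c d where "square_at z c d = square_at x a b"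
    by (auto simp: occurs_in_all_def)
  then have "matches 2 2 x a b z c d"
    by (auto simp: matches_def square_at_def less_2_cases_iff)
  then show "\<exists>c d. matches 2 2 x a b z c d" by blast
qed

section \<open>Windows of arbitrary size\<close>

lemma recurs_mono:
  assumes "recurs n m X" "n' \<le> n" "m' \<le> m"
  shows "recurs n' m' X"
proof -
  have "matches n' m' x a b z c d" if "matches n m x a b z c d" for x a b z c d
    using that assms(2,3) by (simp add: matches_def)
  with assms(1) show ?thesis
    unfolding recurs_def by blast
qed

text \<open>From side 2, the width reaches 3 at level 13 and the height reaches 3 at level 12. From
  then on each turn of the cycle can be used to gain one column or one row.\<close>

lemma recurs_12: "recurs n m (level_set 12)"
proof -
  let ?X = "level_set 12" and ?Y = "level_set 13"
  have XY: "recurs n m ?X" if "recurs n m ?Y" for n m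
    using recurs_desub[OF desub_12, of m n] that by (simp add: recurs_flip)
  have YX: "recurs n m ?Y" if "recurs n m ?X" for n m
    using recurs_desub[OF desub_13, of n m] that by simp
  have "recurs 3 2 ?Y"
    by (rule recurs_desub_three[OF desub_13 desub_12 recurs_two_12 _ single_if_check[OF checks_12_13(3)]]) auto
  then have "recurs 2 3 (flip ` ?Y)"
    by (simp add: recurs_flip)
  moreover have "desub (level_words 13) (flip ` flip ` ?Y) (flip ` flip ` ?X)"
    using desub_13 by (simp add: image_image)
  ultimately have "recurs 3 3 (flip ` ?X)"
    by (intro recurs_desub_three[OF desub_12 _ _ _ single_if_check[OF checks_12_13(4)]]) auto
  then have base: "recurs 3 3 ?X"
    by (simp add: recurs_flip)
  have wider: "recurs (Suc n) m ?X" if "recurs n m ?X" "3 \<le> n" for n m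
    using recurs_desub_expanding[OF desub_13[unfolded level_set_def[of 12]]
        expanding_if_check[OF checks_12_13(1)], of n m] that XY
    by (simp add: level_set_def)
  have higher: "recurs n (Suc m) ?X" if "recurs n m ?X" "3 \<le> m" for n m
  proof -
    have "recurs m n (flip ` ?Y)"
      using YX[OF that(1)] by (simp add: recurs_flip)
    then have "recurs (Suc m) n (flip ` ?X)"
      using recurs_desub_expanding[OF desub_12[unfolded level_set_def[of 13] flip_tilings]
        expanding_if_check[OF checks_12_13(2)], of m n] that(2)
      by (simp add: level_set_def)
    then show ?thesis by (simp add: recurs_flip)
  qed
  have n3: "recurs n 3 ?X" if "3 \<le> n" for n
    using that by (induction n rule: nat_induct_at_least) (use base wider in auto)
  have "recurs n m ?X" if "3 \<le> m" "3 \<le> n" for n m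
    using that by (induction m rule: nat_induct_at_least) (use n3 higher in auto)
  from this[of "max 3 m" "max 3 n"] have "recurs (max 3 n) (max 3 m) ?X"
    by simp
  then show ?thesis
    by (rule recurs_mono[of "max 3 n" "max 3 m"]) auto
qed

section \<open>The shear between levels 5 and 6\<close>

definition shear :: "int \<Rightarrow> (int \<Rightarrow> int \<Rightarrow> nat) \<Rightarrow> int \<Rightarrow> int \<Rightarrow> nat" where
  "shear s x = (\<lambda>i j. x (i + s * j) j)"

text \<open>After the shear, the tile above \<open>x i j\<close> is
  \<open>x (i + 1) (j + 1)\<close>. Here \<open>a\<close> and \<open>b\<close> stand for
  \<open>x i j\<close> and \<open>x (i + 1) j\<close>, and the vertical successors of
  \<open>b\<close> are the candidates for that diagonal neighbor.\<close>

fun shear_check_forward :: "nat \<times> nat \<Rightarrow> bool" where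
  "shear_check_forward (a, b) \<longleftrightarrow>
     h_adj tiles6 a b \<and> list_all (v_adj tiles6 a) (level_v 5 ! b)"

text \<open>For the inverse shear, the tile above \<open>x (i + 1) j\<close> is
  \<open>x i (j + 1)\<close>, a vertical successor of \<open>a\<close>.\<close>

fun shear_check_backward :: "nat \<times> nat \<Rightarrow> bool" where
  "shear_check_backward (a, b) \<longleftrightarrow>
     h_adj tiles5 a b \<and> list_all (v_adj tiles5 b) (level_v 6 ! a)"

lemma shear_checks:
  "list_all shear_check_forward (edges (level_h 5))"
  "list_all shear_check_backward (edges (level_h 6))"
  by code_simp+

lemma level_tiles_5_6: "level_tiles 5 = tiles5" "level_tiles 6 = tiles6"
  by (simp_all add: level_tiles_def eval_nat_numeral)

lemma shear_level_5:
  assumes "x \<in> level_set 5"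
  shows "shear 1 x \<in> level_set 6"
proof -
  note x = tilingsD[OF assms[unfolded level_set_def]]
  have "h_adj tiles6 (x i j) (x (i + 1) j) \<and> v_adj tiles6 (x i j) (x (i + 1) (j + 1))" for i j
  proof -
    have "shear_check_forward (x i j, x (i + 1) j)"
      using x(1)[of i j] shear_checks(1) by (auto simp: adj_iff_edges list_all_iff)
    moreover have "x (i + 1) (j + 1) \<in> set (level_v 5 ! x (i + 1) j)"
      using x(2)[of "i + 1" j] by (simp add: adj_def)
    ultimately show ?thesis
      by (simp add: list_all_iff)
  qed
  from this[of "_ + _" "_"] show ?thesis
    by (simp add: level_set_eq level_tiles_5_6 tilings_def shear_def algebra_simps)
qed

lemma shear_level_6:
  assumes "x \<in> level_set 6"
  shows "shear (- 1) x \<in> level_set 5"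
proof -
  note x = tilingsD[OF assms[unfolded level_set_def]]
  have "h_adj tiles5 (x i j) (x (i + 1) j) \<and> v_adj tiles5 (x (i + 1) j) (x i (j + 1))" for i j
  proof -
    have "shear_check_backward (x i j, x (i + 1) j)"
      using x(1)[of i j] shear_checks(2) by (auto simp: adj_iff_edges list_all_iff)
    moreover have "x i (j + 1) \<in> set (level_v 6 ! x i j)"
      using x(2)[of i j] by (simp add: adj_def)
    ultimately show ?thesis
      by (simp add: list_all_iff)
  qed
  note step = this
  have "h_adj tiles5 (x (i - j) j) (x (i + 1 - j) j)" for i j
    using step[of "i - j" j] by (simp add: algebra_simps)
  moreover have "v_adj tiles5 (x (i - j) j) (x (i - (j + 1)) (j + 1))" for i j
    using step[of "i - j - 1" j] by (simp add: algebra_simps)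
  ultimately show ?thesis
    by (simp add: level_set_eq level_tiles_5_6 tilings_def shear_def)
qed

lemma no_periods_5:
  assumes "no_periods (level_set 6)"
  shows "no_periods (level_set 5)"
  unfolding no_periods_def
proof (intro ballI allI impI)
  fix x a b assume x: "x \<in> level_set 5" "period x a b"
  have "shear 1 x (i + (a - b)) (j + b) = shear 1 x i j" for i j
    using x(2)[unfolded period_def, rule_format, of "i + j" j]
    by (simp add: shear_def algebra_simps)
  then have "period (shear 1 x) (a - b) b"
    by (simp add: period_def)
  with assms shear_level_5[OF x(1)] show "a = 0 \<and> b = 0"
    unfolding no_periods_def by fastforce
qed

lemma recurs_5:
  assumes "\<And>n m. recurs n m (level_set 6)"
  shows "recurs n m (level_set 5)"
  unfolding recurs_def
proof (intro ballI allI)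
  fix x z a b assume "x \<in> level_set 5" "z \<in> level_set 5"
  then have "shear 1 x \<in> level_set 6" "shear 1 z \<in> level_set 6"
    by (simp_all add: shear_level_5)
  \<comment> \<open>In sheared coordinates the cell (a + i, b + j) has column a - b + i - j, so the
    window lies in one of width \<open>n + m\<close> that starts at column a - b - m.\<close>
  then obtain c d where cd: "matches (n + m) m (shear 1 x) (a - b - int m) b (shear 1 z) c d"
    using assms[of "n + m" m] unfolding recurs_def by blast
  have "x (a + int i) (b + int j) = z (c + d + int m + int i) (d + int j)" if "i < n" "j < m" for i j
  proof -
    have "int (i + m - j) = int i + int m - int j" "i + m - j < n + m"
      using that by auto
    with cd[unfolded matches_def, rule_format, of "i + m - j" j] that(2) show ?thesis
      by (simp add: shear_def algebra_simps)
  qed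
  then show "\<exists>c d. matches n m x a b z c d"
    unfolding matches_def by blast
qed

text \<open>The last conjunct is minimality without topology: every window of one tiling appears in
  every other.\<close>

definition minimal_aperiodic :: "(int \<Rightarrow> int \<Rightarrow> nat) set \<Rightarrow> bool" where
  "minimal_aperiodic X \<longleftrightarrow> X \<noteq> {} \<and> no_periods X \<and> (\<forall>n m. recurs n m X)"

lemma minimal_aperiodic_level_6:
  assumes "6 \<le> i" "i \<le> 12"
  shows "minimal_aperiodic (level_set i)"
  using assms(2,1)
proof (induction i rule: inc_induct)
  case base
  show ?case
    using level_set_12_nonempty no_periods_12 recurs_12 by (simp add: minimal_aperiodic_def)
next
  case (step i)
  then have "6 \<le> i" "i \<le> 13" "minimal_aperiodic (level_set (Suc i))"
    by simp_all
  then show ?case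
    using level_set_nonempty level_no_periods level_recurs
    unfolding minimal_aperiodic_def by blast
qed

lemma minimal_aperiodic_level:
  assumes "5 \<le> i" "i \<le> 12"
  shows "minimal_aperiodic (level_set i)"
proof (cases "i = 5")
  case True
  have "minimal_aperiodic (level_set 6)"
    by (rule minimal_aperiodic_level_6) simp_all
  then show ?thesis
    using no_periods_5 recurs_5 shear_level_6 True unfolding minimal_aperiodic_def by blast
qed (use assms minimal_aperiodic_level_6 in simp)

section \<open>Wang shifts\<close>

text \<open>The index is chosen as a function of the tile, which turns periods of \<open>f\<close>
  into periods of \<open>x\<close>.\<close>

lemma ex_indices:
  assumes "f \<in> wang_shift (set ts)"
  obtains x where "x \<in> tilings (h_adj ts) (v_adj ts)" "\<forall>i j. f (i, j) = ts ! x i j"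
    "\<forall>a b. shift (a, b) f = f \<longrightarrow> period x a b"
proof -
  define index where "index t = (SOME a. a < length ts \<and> ts ! a = t)" for t
  have index: "index t < length ts \<and> ts ! index t = t" if "t \<in> set ts" for t
    using that unfolding index_def in_set_conv_nth by (rule someI_ex)
  define x where "x i j = index (f (i, j))" for i j
  have f: "f p \<in> set ts" "right_color (f p) = left_color (f (p + (1, 0)))"
    "top_color (f p) = bottom_color (f (p + (0, 1)))" for p
    using assms unfolding wang_shift_def by blast+
  have x: "x i j < length ts" "ts ! x i j = f (i, j)" for i j
    using index[OF f(1)[of "(i, j)"]] by (simp_all add: x_def)
  have "h_adj ts (x i j) (x (i + 1) j)" "v_adj ts (x i j) (x i (j + 1))" for i j
    using f(2,3)[of "(i, j)"] by (simp_all add: h_adj_def v_adj_def x)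
  then have "x \<in> tilings (h_adj ts) (v_adj ts)"
    by (simp add: tilings_def)
  moreover have "\<forall>i j. f (i, j) = ts ! x i j"
    by (simp add: x(2))
  moreover have "period x a b" if "shift (a, b) f = f" for a b
    unfolding period_def x_def using that by (metis add_Pair shift_def)
  then have "\<forall>a b. shift (a, b) f = f \<longrightarrow> period x a b"
    by blast
  ultimately show ?thesis
    by (rule that)
qed

lemma wang_shift_nonempty:
  assumes "tilings (h_adj ts) (v_adj ts) \<noteq> {}"
  shows "wang_shift (set ts) \<noteq> {}"
proof -
  from assms obtain x where "x \<in> tilings (h_adj ts) (v_adj ts)" by blast
  then have "(\<lambda>(i, j). ts ! x i j) \<in> wang_shift (set ts)"
    by (auto simp: wang_shift_def tilings_def h_adj_def v_adj_def)
  then show ?thesis by blast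
qed

lemma aperiodic_wang_shift:
  assumes "minimal_aperiodic (tilings (h_adj ts) (v_adj ts))"
  shows "aperiodic (wang_shift (set ts))"
  unfolding aperiodic_def
proof (intro conjI notI)
  show "wang_shift (set ts) = {} \<Longrightarrow> False"
    using assms wang_shift_nonempty by (auto simp: minimal_aperiodic_def)
next
  assume "\<exists>f\<in>wang_shift (set ts). \<exists>n. n \<noteq> 0 \<and> shift n f = f"
  then obtain f a b where f: "f \<in> wang_shift (set ts)" "(a, b) \<noteq> 0" "shift (a, b) f = f"
    by auto
  obtain x where "x \<in> tilings (h_adj ts) (v_adj ts)" "\<forall>i j. f (i, j) = ts ! x i j"
    "\<forall>a b. shift (a, b) f = f \<longrightarrow> period x a b"
    by (rule ex_indices[OF f(1)])
  with assms f(3) have "a = 0 \<and> b = 0"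
    unfolding minimal_aperiodic_def no_periods_def by blast
  with f(2) show False
    by (simp add: zero_prod_def)
qed

lemma ex_shift_agreeing:
  assumes "minimal_aperiodic (tilings (h_adj ts) (v_adj ts))"
    and "f \<in> wang_shift (set ts)" "g \<in> wang_shift (set ts)" and "finite F"
  shows "\<exists>n. \<forall>p\<in>F. shift n g p = f p"
proof -
  obtain x where x: "x \<in> tilings (h_adj ts) (v_adj ts)" "\<forall>i j. f (i, j) = ts ! x i j"
    "\<forall>a b. shift (a, b) f = f \<longrightarrow> period x a b"
    by (rule ex_indices[OF assms(2)])
  obtain z where z: "z \<in> tilings (h_adj ts) (v_adj ts)" "\<forall>i j. g (i, j) = ts ! z i j"
    "\<forall>a b. shift (a, b) g = g \<longrightarrow> period z a b"
    by (rule ex_indices[OF assms(3)])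
  have "finite ((\<lambda>p. \<bar>fst p\<bar> + \<bar>snd p\<bar>) ` F)"
    using assms(4) by simp
  then obtain N where N: "\<And>p. p \<in> F \<Longrightarrow> \<bar>fst p\<bar> + \<bar>snd p\<bar> \<le> N"
    by (meson bdd_above_finite bdd_above_def imageI)
  define n where "n = nat (2 * N + 1)"
  obtain c d where cd: "matches n n x (- N) (- N) z c d"
    using assms(1) x(1) z(1) unfolding minimal_aperiodic_def recurs_def by blast
  have "shift (c + N, d + N) g p = f p" if "p \<in> F" for p
  proof -
    obtain i j where p: "p = (i, j)" by fastforce
    with N[OF that] have "\<bar>i\<bar> + \<bar>j\<bar> \<le> N" by simp
    then have "nat (i + N) < n" "nat (j + N) < n" "int (nat (i + N)) = i + N" "int (nat (j + N)) = j + N"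
      by (auto simp: n_def)
    with cd[unfolded matches_def, rule_format, of "nat (i + N)" "nat (j + N)"]
    show ?thesis
      by (simp add: p shift_def x(2) z(2) algebra_simps)
  qed
  then show ?thesis by blast
qed

text \<open>A point \<open>f\<close> outside the closed set \<open>Y\<close> has a basic
  neighborhood that avoids \<open>Y\<close> and constrains finitely many cells. By recurrence some
  shift of a point of \<open>Y\<close> agrees with \<open>f\<close> on these cells, and it is still
  in \<open>Y\<close>.\<close>

lemma minimal_wang_shift:
  assumes "minimal_aperiodic (tilings (h_adj ts) (v_adj ts))"
  shows "minimal_subshift (set ts) (wang_shift (set ts))"
  unfolding minimal_subshift_def
proof (intro conjI notI subshift_wang_shift)
  let ?T = "config_topology (set ts)" and ?X = "wang_shift (set ts)"
  assume "\<exists>Y. Y \<noteq> {} \<and> Y \<subset> ?X \<and> closedin ?T Y \<and> shift_invariant Y"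
  then obtain Y g f where Y: "Y \<subseteq> ?X" "closedin ?T Y" "shift_invariant Y"
    and g: "g \<in> Y" and f: "f \<in> ?X" "f \<notin> Y"
    by blast
  have f': "f \<in> topspace ?T - Y"
    using f by (auto simp: wang_shift_def config_topology_def PiE_def Pi_def simp del: split_paired_All)
  have "openin ?T (topspace ?T - Y)"
    using Y(2) by blast
  then have "\<forall>h\<in>topspace ?T - Y. \<exists>U. finite {p \<in> UNIV. U p \<noteq> topspace (discrete_topology (set ts))} \<and>
      (\<forall>p\<in>UNIV. openin (discrete_topology (set ts)) (U p)) \<and> h \<in> Pi\<^sub>E UNIV U \<and>
      Pi\<^sub>E UNIV U \<subseteq> topspace ?T - Y"
    unfolding config_topology_def openin_product_topology_alt .
  from bspec[OF this f'] obtain U where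
    "finite {p \<in> UNIV. U p \<noteq> topspace (discrete_topology (set ts))}"
    and U: "f \<in> Pi\<^sub>E UNIV U" "Pi\<^sub>E UNIV U \<subseteq> topspace ?T - Y"
    by blast
  then have fin: "finite {p. U p \<noteq> set ts}"
    by simp
  obtain n where n: "\<And>p. U p \<noteq> set ts \<Longrightarrow> shift n g p = f p"
    using ex_shift_agreeing[OF assms f(1) _ fin] g Y(1) by blast
  have "shift n g \<in> Y"
    using Y(3) g unfolding shift_invariant_def by blast
  moreover have "shift n g \<in> Pi\<^sub>E UNIV U"
  proof -
    have "shift n g p \<in> U p" for p
    proof (cases "U p = set ts")
      case True
      have "shift n g \<in> ?X"
        using \<open>shift n g \<in> Y\<close> Y(1) by blast
      with True show ?thesis
        unfolding wang_shift_def by blast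
    next
      case False
      with n PiE_mem[OF U(1), of p] show ?thesis by simp
    qed
    then show ?thesis by (simp add: PiE_iff)
  qed
  ultimately show False
    using U(2) by blast
qed

theorem corollary4:
  fixes i :: nat
  assumes "5 \<le> i" and "i \<le> 12"
  shows "aperiodic (wang_shift (tile_set i)) \<and>
         minimal_subshift (tile_set i) (wang_shift (tile_set i))"
proof -
  have "level_set i = tilings (h_adj (tile_list i)) (v_adj (tile_list i))"
    using assms by (simp add: level_set_eq level_tiles_def)
  with minimal_aperiodic_level[OF assms]
  have "minimal_aperiodic (tilings (h_adj (tile_list i)) (v_adj (tile_list i)))"
    by simp
  then show ?thesis
    unfolding tile_set_def using aperiodic_wang_shift minimal_wang_shift by blast
qed

end
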